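(* The Clique-Matching problem can be solved in $O(mn^4)$ time on bipartite permutation graphs.
   Context: A matching $M$ in a graph $G$ is a clique-matching if for any two distinct edges $e_1,e_2\in M$ there is an edge in $G$ between an end-vertex of $e_1$ and an end-vertex of $e_2$. The Clique-Matching problem asks, given a graph $G$ and a positive integer $k$, whether $G$ has a clique-matching of size at least $k$. A bipartite permutation graph is a graph that is both bipartite and a permutation graph. $n$ and $m$ denote the number of vertices and edges of the input graph. *)

theory Defs
  imports Main "HOL-Combinatorics.Permutations"
begin

section \<open>Graphs and clique-matchings\<close>

definition simple_graph :: "'a set \<Rightarrow> 'a set set \<Rightarrow> bool" where
  "simple_graph V E \<longleftrightarrow> finite V \<and> (\<forall>e\<in>E. e \<subseteq> V \<and> card e = 2)"

definition bipartite :: "'a set \<Rightarrow> 'a set set \<Rightarrow> bool" where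
  "bipartite V E \<longleftrightarrow>
     (\<exists>A B. A \<union> B = V \<and> A \<inter> B = {} \<and> (\<forall>e\<in>E. \<exists>a\<in>A. \<exists>b\<in>B. e = {a, b}))"

text \<open>After numbering the vertices from 1 to \<open>n\<close>, the edges are exactly the pairs
  inverted by some permutation of the numbers.\<close>

definition permutation_graph :: "'a set \<Rightarrow> 'a set set \<Rightarrow> bool" where
  "permutation_graph V E \<longleftrightarrow>
     (\<exists>\<sigma> \<pi>. bij_betw \<sigma> V {1..card V} \<and> \<pi> permutes {1..card V} \<and>
        (\<forall>u\<in>V. \<forall>v\<in>V. \<sigma> u < \<sigma> v \<longrightarrow> ({u, v} \<in> E \<longleftrightarrow> \<pi> (\<sigma> u) > \<pi> (\<sigma> v))))"

definition bipartite_permutation_graph :: "'a set \<Rightarrow> 'a set set \<Rightarrow> bool" where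
  "bipartite_permutation_graph V E \<longleftrightarrow>
     simple_graph V E \<and> bipartite V E \<and> permutation_graph V E"

definition matching :: "'a set set \<Rightarrow> 'a set set \<Rightarrow> bool" where
  "matching E M \<longleftrightarrow> M \<subseteq> E \<and> (\<forall>e1\<in>M. \<forall>e2\<in>M. e1 \<noteq> e2 \<longrightarrow> e1 \<inter> e2 = {})"

definition clique_matching :: "'a set set \<Rightarrow> 'a set set \<Rightarrow> bool" where
  "clique_matching E M \<longleftrightarrow> matching E M \<and>
     (\<forall>e1\<in>M. \<forall>e2\<in>M. e1 \<noteq> e2 \<longrightarrow> (\<exists>u\<in>e1. \<exists>v\<in>e2. {u, v} \<in> E))"

definition has_clique_matching :: "'a set set \<Rightarrow> nat \<Rightarrow> bool" where
  "has_clique_matching E k \<longleftrightarrow> (\<exists>M. clique_matching E M \<and> card M \<ge> k)"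

section \<open>Model of computation\<close>

text \<open>
  A uniform-cost random access machine with structured control flow. The memory consists of
  named arrays of natural numbers (a program mentions only finitely many names); a scalar
  variable \<open>x\<close> is the cell \<open>x[0]\<close>. The only arithmetic operations are addition and truncated
  subtraction. There is deliberately no unit-cost multiplication, division or shift, since on
  unbounded numbers these would make the machine unreasonably powerful. Every node of an
  expression and every command executed costs one time unit.
\<close>

type_synonym state = "string \<Rightarrow> nat \<Rightarrow> nat"

datatype aexp =
    Const nat
  | Cell string aexp
  | Plus aexp aexp
  | Minus aexp aexp

datatype bexp =
    Less aexp aexp
  | Equal aexp aexp
  | Neg bexp
  | And bexp bexp

datatype com =
    Skip
  | Assign string aexp aexp  \<comment> \<open>\<open>Assign x i a\<close> stores the value of \<open>a\<close> in \<open>x[i]\<close>\<close>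
  | Seq com com
  | Cond bexp com com
  | While bexp com

primrec aval :: "aexp \<Rightarrow> state \<Rightarrow> nat" where
  "aval (Const c) s = c"
| "aval (Cell x a) s = s x (aval a s)"
| "aval (Plus a b) s = aval a s + aval b s"
| "aval (Minus a b) s = aval a s - aval b s"

primrec bval :: "bexp \<Rightarrow> state \<Rightarrow> bool" where
  "bval (Less a b) s \<longleftrightarrow> aval a s < aval b s"
| "bval (Equal a b) s \<longleftrightarrow> aval a s = aval b s"
| "bval (Neg b) s \<longleftrightarrow> \<not> bval b s"
| "bval (And b c) s \<longleftrightarrow> bval b s \<and> bval c s"

primrec acost :: "aexp \<Rightarrow> nat" where
  "acost (Const c) = 1"
| "acost (Cell x a) = acost a + 1"
| "acost (Plus a b) = acost a + acost b + 1"
| "acost (Minus a b) = acost a + acost b + 1"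

primrec bcost :: "bexp \<Rightarrow> nat" where
  "bcost (Less a b) = acost a + acost b + 1"
| "bcost (Equal a b) = acost a + acost b + 1"
| "bcost (Neg b) = bcost b + 1"
| "bcost (And b c) = bcost b + bcost c + 1"

definition store :: "state \<Rightarrow> string \<Rightarrow> nat \<Rightarrow> nat \<Rightarrow> state" where
  "store s x i v = s(x := (s x)(i := v))"

text \<open>\<open>exec p s t s'\<close>: program \<open>p\<close> started in \<open>s\<close> halts in \<open>s'\<close> after exactly \<open>t\<close> time units.\<close>

inductive exec :: "com \<Rightarrow> state \<Rightarrow> nat \<Rightarrow> state \<Rightarrow> bool" where
  Skip: "exec Skip s 1 s"
| Assign: "exec (Assign x i a) s (acost i + acost a + 1) (store s x (aval i s) (aval a s))"
| Seq: "exec c1 s t1 s1 \<Longrightarrow> exec c2 s1 t2 s2 \<Longrightarrow> exec (Seq c1 c2) s (t1 + t2 + 1) s2"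
| CondTrue: "bval b s \<Longrightarrow> exec c1 s t s1 \<Longrightarrow> exec (Cond b c1 c2) s (bcost b + t + 1) s1"
| CondFalse: "\<not> bval b s \<Longrightarrow> exec c2 s t s1 \<Longrightarrow> exec (Cond b c1 c2) s (bcost b + t + 1) s1"
| WhileFalse: "\<not> bval b s \<Longrightarrow> exec (While b c) s (bcost b + 1) s"
| WhileTrue: "bval b s \<Longrightarrow> exec c s t1 s1 \<Longrightarrow> exec (While b c) s1 t2 s2 \<Longrightarrow>
    exec (While b c) s (bcost b + t1 + t2 + 1) s2"

inductive_cases SkipE: "exec Skip s t s'"
inductive_cases AssignE: "exec (Assign x i a) s t s'"
inductive_cases SeqE: "exec (Seq c1 c2) s t s'"
inductive_cases CondE: "exec (Cond b c1 c2) s t s'"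
inductive_cases WhileE: "exec (While b c) s t s'"

lemma exec_deterministic:
  "exec p s t s' \<Longrightarrow> exec p s u s'' \<Longrightarrow> u = t \<and> s'' = s'"
proof (induction arbitrary: u s'' rule: exec.induct)
  case (Skip s)
  then show ?case by (auto elim: SkipE)
next
  case (Assign x i a s)
  then show ?case by (auto elim: AssignE)
next
  case (Seq c1 s t1 s1 c2 t2 s2)
  from Seq.prems obtain u1 r u2 where
    "exec c1 s u1 r" "exec c2 r u2 s''" "u = u1 + u2 + 1" by (auto elim: SeqE)
  with Seq.IH show ?case by metis
next
  case (CondTrue b s c1 t s1 c2)
  from CondTrue.prems obtain v where "exec c1 s v s''" "u = bcost b + v + 1"
    using CondTrue.hyps by (auto elim: CondE)
  with CondTrue.IH show ?case by metis
next
  case (CondFalse b s c2 t s1 c1)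
  from CondFalse.prems obtain v where "exec c2 s v s''" "u = bcost b + v + 1"
    using CondFalse.hyps by (auto elim: CondE)
  with CondFalse.IH show ?case by metis
next
  case (WhileFalse b s c)
  from WhileFalse.prems show ?case
    by (rule WhileE) (use WhileFalse.hyps in simp_all)
next
  case (WhileTrue b s c t1 s1 t2 s2)
  from WhileTrue.prems obtain u1 r u2 where
    "exec c s u1 r" "exec (While b c) r u2 s''" "u = bcost b + u1 + u2 + 1"
    by (rule WhileE) (use WhileTrue.hyps in simp_all)
  with WhileTrue.IH show ?case by metis
qed

text \<open>A decision program reports its verdict in the variable \<open>ans\<close>: 1 for yes, 0 for no.\<close>

definition decides_within :: "com \<Rightarrow> state \<Rightarrow> bool \<Rightarrow> nat \<Rightarrow> bool" where
  "decides_within p s verdict T \<longleftrightarrow>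
     (\<exists>t s'. exec p s t s' \<and> t \<le> T \<and> s' ''ans'' 0 = (if verdict then 1 else 0))"

section \<open>Encoding of instances\<close>

text \<open>
  The vertices are \<open>0, \<dots>, n - 1\<close>. The edges are given in arbitrary order and orientation, each
  one once. All cells not mentioned are initially 0.
\<close>

definition edge_listing :: "'a set set \<Rightarrow> ('a \<times> 'a) list \<Rightarrow> bool" where
  "edge_listing E es \<longleftrightarrow>
     distinct (map (\<lambda>(u, v). {u, v}) es) \<and> set (map (\<lambda>(u, v). {u, v}) es) = E"

definition input_state :: "nat \<Rightarrow> (nat \<times> nat) list \<Rightarrow> nat \<Rightarrow> state" where
  "input_state n es k = (\<lambda>x i.
     if x = ''n'' \<and> i = 0 then n
     else if x = ''m'' \<and> i = 0 then length es
     else if x = ''k'' \<and> i = 0 then k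
     else if x = ''src'' \<and> i < length es then fst (es ! i)
     else if x = ''dst'' \<and> i < length es then snd (es ! i)
     else 0)"

end

theory Submission
  imports Defs
begin

text \<open>
  In the permutation diagram of a bipartite permutation graph every edge of a matching has an
  upper and a lower endpoint. If the matching is a clique-matching, the edges at the leftmost and
  at the rightmost lower endpoint are joined, so one of their upper endpoints is adjacent to both
  of these lower endpoints, and hence to all lower endpoints in between. Removing the edge at this
  upper endpoint and iterating yields a chain \<open>L\<^sub>1 \<supset> \<dots> \<supset> L\<^sub>k\<close> of sets of lower
  endpoints such that \<open>L\<^sub>i\<close> has \<open>k + 1 - i\<close> elements and at least \<open>i\<close> common neighbours, which
  are the common neighbours of just its two extreme elements. Conversely, such a chain gives a
  clique-matching in any bipartite graph.

  The program searches for this chain backwards. A state is a pair \<open>(x, y)\<close> standing for the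
  extreme elements of some \<open>L\<^sub>i\<close>, a step replaces one of them, and the size of \<open>L\<^sub>i\<close> is relaxed to
  the number of vertices adjacent to all common neighbours of \<open>x\<close> and \<open>y\<close>, so no vertex ordering
  has to be computed. As \<open>k\<close> is at most the number of edges, \<open>m\<close> rounds suffice; each tries all
  steps \<open>(x, y, z)\<close> at linear cost.
\<close>

section \<open>Common neighbours, closures and the levels of the search\<close>

definition nbrs :: "'a set set \<Rightarrow> 'a \<Rightarrow> 'a set" where
  "nbrs E x = {u. {x, u} \<in> E}"

definition common_nbrs :: "'a set set \<Rightarrow> 'a \<Rightarrow> 'a \<Rightarrow> 'a set" where
  "common_nbrs E x y = nbrs E x \<inter> nbrs E y"

definition closure :: "'a set \<Rightarrow> 'a set set \<Rightarrow> 'a \<Rightarrow> 'a \<Rightarrow> 'a set" where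
  "closure V E x y = {z \<in> V. common_nbrs E x y \<subseteq> nbrs E z}"

text \<open>If \<open>(x, z)\<close> stands for \<open>L\<^sub>i\<close> and \<open>(x, y)\<close>
  for the next smaller set of the chain, the latter has \<open>k - i\<close> elements and the former
  at least \<open>i\<close> common neighbours; hence the threshold \<open>k\<close> for the sum. The
  inclusion makes the common neighbours shrink along the search, and nonemptiness keeps some vertex
  adjacent to the whole closure.\<close>

definition step :: "'a set \<Rightarrow> 'a set set \<Rightarrow> nat \<Rightarrow> 'a \<Rightarrow> 'a \<Rightarrow> 'a \<Rightarrow> bool" where
  "step V E k x y z \<longleftrightarrow> z \<in> V \<and> common_nbrs E x z \<noteq> {} \<and> common_nbrs E x z \<subseteq> nbrs E y \<and>
     k \<le> card (closure V E x y) + card (common_nbrs E x z)"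

text \<open>Level \<open>r\<close> is meant to contain the extremes of the set with
  \<open>r + 1\<close> elements. Both orders of a pair are added, so \<open>step\<close> may always
  replace the second component.\<close>

primrec level :: "'a set \<Rightarrow> 'a set set \<Rightarrow> nat \<Rightarrow> nat \<Rightarrow> ('a \<times> 'a) set" where
  "level V E k 0 = {(x, x) |x. x \<in> V \<and> k \<le> card (nbrs E x)}"
| "level V E k (Suc r) =
     {q. \<exists>x y z. (x, y) \<in> level V E k r \<and> step V E k x y z \<and> (q = (x, z) \<or> q = (z, x))}"

lemma nbrs_sym: "u \<in> nbrs E x \<longleftrightarrow> x \<in> nbrs E u"
  by (simp add: nbrs_def insert_commute)

lemma nbrs_subset: "simple_graph V E \<Longrightarrow> nbrs E x \<subseteq> V"
  by (auto simp: nbrs_def simple_graph_def)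

lemma not_nbrs_self: "simple_graph V E \<Longrightarrow> x \<notin> nbrs E x"
  by (auto simp: nbrs_def simple_graph_def)

lemma finite_nbrs: "simple_graph V E \<Longrightarrow> finite (nbrs E x)"
  using nbrs_subset finite_subset simple_graph_def by metis

lemma finite_common_nbrs: "simple_graph V E \<Longrightarrow> finite (common_nbrs E x y)"
  by (simp add: common_nbrs_def finite_nbrs)

lemma common_nbrs_commute: "common_nbrs E x y = common_nbrs E y x"
  by (auto simp: common_nbrs_def)

lemma closure_commute: "closure V E x y = closure V E y x"
  by (simp add: closure_def common_nbrs_commute)

lemma finite_closure: "simple_graph V E \<Longrightarrow> finite (closure V E x y)"
  by (simp add: closure_def simple_graph_def)

lemma closure_mono:
  "common_nbrs E x' y' \<subseteq> common_nbrs E x y \<Longrightarrow> closure V E x y \<subseteq> closure V E x' y'"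
  by (auto simp: closure_def)

lemma level_commute: "(x, y) \<in> level V E k r \<Longrightarrow> (y, x) \<in> level V E k r"
  by (cases r) auto

lemma bipartite_nbrs:
  assumes "bipartite V E"
  obtains X where "\<And>u v. v \<in> nbrs E u \<Longrightarrow> u \<in> X \<longleftrightarrow> v \<notin> X"
proof -
  obtain X Y where XY: "X \<inter> Y = {}" "\<forall>e\<in>E. \<exists>a\<in>X. \<exists>b\<in>Y. e = {a, b}"
    using assms by (auto simp: bipartite_def)
  have "u \<in> X \<longleftrightarrow> v \<notin> X" if "v \<in> nbrs E u" for u v
  proof -
    have "{u, v} \<in> E" using that by (simp add: nbrs_def)
    from bspec[OF XY(2) this] obtain a b where "a \<in> X" "b \<in> Y" "{u, v} = {a, b}"
      by (elim bexE)
    then show ?thesis using XY(1) by (auto simp: doubleton_eq_iff)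
  qed
  then show thesis using that by blast
qed

section \<open>From levels to clique-matchings\<close>

text \<open>Edges are oriented here, since two of them are required to be joined by an edge between a first
  and a second component. Taking the two pairs equal shows that the pairs themselves are edges.\<close>

definition clique_pairs :: "'a set set \<Rightarrow> ('a \<times> 'a) set \<Rightarrow> bool" where
  "clique_pairs E M \<longleftrightarrow> finite M \<and> inj_on fst M \<and> inj_on snd M \<and>
     (\<forall>(u, l) \<in> M. \<forall>(u', l') \<in> M. l' \<in> nbrs E u \<or> l \<in> nbrs E u')"

lemma clique_pairs_nbrs: "clique_pairs E M \<Longrightarrow> (u, l) \<in> M \<Longrightarrow> l \<in> nbrs E u"
  unfolding clique_pairs_def by blast

lemma clique_pairs_extend:
  assumes M: "clique_pairs E M" "card M = k - card A" "fst ` M \<inter> A = {}" "snd ` M \<subseteq> B"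
    and fin: "finite A" "finite B"
    and "A' \<subseteq> A" and bic: "\<And>a b. a \<in> A \<Longrightarrow> b \<in> B \<Longrightarrow> b \<in> nbrs E a"
    and large: "k \<le> card B + card A'"
  obtains M' where "clique_pairs E M'" "card M' = k - card A'" "fst ` M' \<inter> A' = {}" "snd ` M' \<subseteq> B"
proof -
  have finM: "finite M" and inj: "inj_on fst M" "inj_on snd M"
    using M(1) by (auto simp: clique_pairs_def)
  define c where "c = (k - card A') - (k - card A)"
  have cA: "card A' \<le> card A" using assms by (simp add: card_mono)
  have "c \<le> card (A - A')"
    using cA assms finite_subset[OF \<open>A' \<subseteq> A\<close>] by (simp add: c_def card_Diff_subset)
  then obtain D where D: "D \<subseteq> A - A'" "card D = c"
    by (meson obtain_subset_with_card_n)
  have "c \<le> card (B - snd ` M)"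
    using cA large M(2) finM inj M(4) by (simp add: c_def card_Diff_subset card_image)
  then obtain F where F: "F \<subseteq> B - snd ` M" "card F = c"
    by (meson obtain_subset_with_card_n)
  have finDF: "finite D" "finite F" using D F fin by (auto intro: finite_subset)
  then obtain g where g: "bij_betw g D F"
    using D F by (metis finite_same_card_bij)
  define N where "N = (\<lambda>a. (a, g a)) ` D"
  have gF: "g a \<in> F" if "a \<in> D" for a using g that by (auto simp: bij_betw_def)
  have N: "finite N" "card N = c" "inj_on fst N" "inj_on snd N" "fst ` N = D" "snd ` N = F"
    using finDF D g by (auto simp: N_def card_image inj_on_def bij_betw_def image_image)
  have disj: "fst ` M \<inter> fst ` N = {}" "snd ` M \<inter> snd ` N = {}"
    unfolding N(5,6) using D F M(3) by auto
  have "clique_pairs E (M \<union> N)"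
    unfolding clique_pairs_def
  proof (intro conjI)
    show "inj_on fst (M \<union> N)" "inj_on snd (M \<union> N)"
      using inj N(3,4) disj by (auto simp: inj_on_Un)
    show "\<forall>(u, l)\<in>M \<union> N. \<forall>(u', l')\<in>M \<union> N. l' \<in> nbrs E u \<or> l \<in> nbrs E u'"
    proof (clarify)
      fix u l u' l'
      assume a: "(u, l) \<in> M \<union> N" "(u', l') \<in> M \<union> N" "l \<notin> nbrs E u'"
      have inB: "l \<in> B" "l' \<in> B"
        using a M(4) F N(6) by (force, force)
      have inA: "u \<in> A" if "(u, l) \<in> N" for u l
        using that N(5) D by force
      show "l' \<in> nbrs E u"
        using a inA inB bic M(1) unfolding clique_pairs_def by blast
    qed
  qed (use finM N in auto)
  moreover have "card (M \<union> N) = k - card A'"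
  proof -
    have "M \<inter> N = {}" using disj by auto
    then have "card (M \<union> N) = card M + c" using finM N by (simp add: card_Un_disjoint)
    then show ?thesis using M(2) cA by (simp add: c_def)
  qed
  moreover have "fst ` (M \<union> N) \<inter> A' = {}"
    unfolding image_Un N(5) using M(3) D \<open>A' \<subseteq> A\<close> by auto
  moreover have "snd ` (M \<union> N) \<subseteq> B"
    unfolding image_Un N(6) using M(4) F by auto
  ultimately show thesis using that by blast
qed

lemma closure_biclique:
  "a \<in> common_nbrs E x y \<Longrightarrow> b \<in> closure V E x y \<Longrightarrow> b \<in> nbrs E a"
  using nbrs_sym by (fastforce simp: closure_def)

text \<open>Invariant of the search: the pairs built so far together with the reserve
  \<open>common_nbrs E x y\<close> number at least \<open>k\<close>. A step drops some vertices from
  the reserve; \<open>clique_pairs_extend\<close> turns enough of them into pairs, and the closure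
  only grows.\<close>

lemma level_clique_pairs:
  assumes G: "simple_graph V E" and "k \<ge> 1"
  shows "(x, y) \<in> level V E k r \<Longrightarrow> common_nbrs E x y \<noteq> {} \<and> x \<in> V \<and> y \<in> V \<and>
    (\<exists>M. clique_pairs E M \<and> card M = k - card (common_nbrs E x y) \<and>
      fst ` M \<inter> common_nbrs E x y = {} \<and> snd ` M \<subseteq> closure V E x y)"
proof (induction r arbitrary: x y)
  case 0
  then have "x = y" "x \<in> V" "k \<le> card (common_nbrs E x y)"
    by (auto simp: common_nbrs_def)
  moreover from this have "common_nbrs E x y \<noteq> {}" using \<open>k \<ge> 1\<close> by auto
  ultimately show ?case by (auto simp: clique_pairs_def intro!: exI[of _ "{}"])
next
  case (Suc r)
  then obtain a b z where *: "(a, b) \<in> level V E k r" "step V E k a b z"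
    "(x, y) = (a, z) \<or> (x, y) = (z, a)" by auto
  from Suc.IH[OF *(1)] obtain M where M: "clique_pairs E M" "card M = k - card (common_nbrs E a b)"
    "fst ` M \<inter> common_nbrs E a b = {}" "snd ` M \<subseteq> closure V E a b" and aV: "a \<in> V" by auto
  have sub: "common_nbrs E a z \<subseteq> common_nbrs E a b"
    and st: "common_nbrs E a z \<noteq> {}" "z \<in> V"
      "k \<le> card (closure V E a b) + card (common_nbrs E a z)"
    using *(2) by (auto simp: step_def common_nbrs_def)
  obtain M' where "clique_pairs E M'" "card M' = k - card (common_nbrs E a z)"
    "fst ` M' \<inter> common_nbrs E a z = {}" "snd ` M' \<subseteq> closure V E a b"
    using clique_pairs_extend[OF M finite_common_nbrs[OF G] finite_closure[OF G] sub _ st(3)]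
      closure_biclique by metis
  moreover have "closure V E a b \<subseteq> closure V E a z" using closure_mono[OF sub] .
  ultimately have "common_nbrs E a z \<noteq> {} \<and> a \<in> V \<and> z \<in> V \<and>
    (\<exists>M. clique_pairs E M \<and> card M = k - card (common_nbrs E a z) \<and>
      fst ` M \<inter> common_nbrs E a z = {} \<and> snd ` M \<subseteq> closure V E a z)"
    using st aV by blast
  then show ?case
    using *(3) by (auto simp: common_nbrs_commute[of E z a] closure_commute[of V E z a])
qed

text \<open>The common neighbour \<open>a\<close> puts all second components on one side of the
  bipartition and hence all first components on the other. So no vertex occurs in both roles, and
  distinct pairs give disjoint edges.\<close>

lemma clique_pairs_clique_matching:
  assumes bip: "bipartite V E" and M: "clique_pairs E M" and com: "snd ` M \<subseteq> nbrs E a"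
  shows "has_clique_matching E (card M)"
proof -
  obtain X where X: "\<And>u v. v \<in> nbrs E u \<Longrightarrow> u \<in> X \<longleftrightarrow> v \<notin> X"
    using bipartite_nbrs[OF bip] by blast
  have sep: "u \<noteq> l'" if "(u, l) \<in> M" "(u', l') \<in> M" for u l u' l'
  proof -
    have "l \<in> nbrs E a" "l' \<in> nbrs E a" using that com by force+
    then show ?thesis
      using X clique_pairs_nbrs[OF M that(1)] by blast
  qed
  define S where "S = (\<lambda>(u, l). {u, l}) ` M"
  have inj: "inj_on fst M" "inj_on snd M" using M by (auto simp: clique_pairs_def)
  have "inj_on (\<lambda>(u, l). {u, l}) M"
    using sep by (fastforce simp: inj_on_def doubleton_eq_iff)
  then have "card S = card M" by (simp add: S_def card_image)
  moreover have "S \<subseteq> E"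
    using clique_pairs_nbrs[OF M] by (auto simp: S_def nbrs_def)
  moreover have "(e1 \<inter> e2 = {}) \<and> (\<exists>u\<in>e1. \<exists>v\<in>e2. {u, v} \<in> E)"
    if e12: "e1 \<in> S" "e2 \<in> S" "e1 \<noteq> e2" for e1 e2
  proof -
    obtain q q' where "q \<in> M" "q' \<in> M" "e1 = (\<lambda>(u, l). {u, l}) q" "e2 = (\<lambda>(u, l). {u, l}) q'"
      using e12(1,2) unfolding S_def by (elim imageE)
    then obtain u l u' l' where
      uv: "(u, l) \<in> M" "(u', l') \<in> M" "e1 = {u, l}" "e2 = {u', l'}"
      by (cases q, cases q') auto
    then have "u \<noteq> u'" "l \<noteq> l'" using e12(3) inj_onD[OF inj(1) _ uv(1,2)] inj_onD[OF inj(2) _ uv(1,2)] by auto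
    moreover have "u \<noteq> l'" "u' \<noteq> l" using sep uv by blast+
    moreover have "{u, l'} \<in> E \<or> {l, u'} \<in> E"
      using M uv unfolding clique_pairs_def nbrs_def by (fastforce simp: insert_commute)
    ultimately show ?thesis using uv by auto
  qed
  ultimately show ?thesis
    unfolding has_clique_matching_def clique_matching_def matching_def
    by (intro exI[of _ S] conjI ballI impI) auto
qed

text \<open>One last extension with \<open>A' = {}\<close> spends the reserve and yields exactly
  \<open>k\<close> pairs; this is possible because the closure has \<open>k\<close>
  elements.\<close>

lemma level_sound:
  assumes G: "simple_graph V E" and "bipartite V E" and "k \<ge> 1"
    and lev: "(x, y) \<in> level V E k r" and large: "k \<le> card (closure V E x y)"
  shows "has_clique_matching E k"
proof -
  from level_clique_pairs[OF G \<open>k \<ge> 1\<close> lev] obtain M a where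
    M: "clique_pairs E M" "card M = k - card (common_nbrs E x y)"
    "fst ` M \<inter> common_nbrs E x y = {}" "snd ` M \<subseteq> closure V E x y"
    and a: "a \<in> common_nbrs E x y" by auto
  obtain M' where M': "clique_pairs E M'" "card M' = k" "snd ` M' \<subseteq> closure V E x y"
    using clique_pairs_extend[OF M finite_common_nbrs[OF G] finite_closure[OF G], of "{}"]
      closure_biclique large by (metis add.right_neutral card.empty diff_zero empty_subsetI)
  then have "snd ` M' \<subseteq> nbrs E a" using closure_biclique[OF a] by blast
  then show ?thesis using clique_pairs_clique_matching \<open>bipartite V E\<close> M' by metis
qed

section \<open>From clique-matchings to levels\<close>

locale permutation_diagram =
  fixes V :: "'a set" and E :: "'a set set" and s p :: "'a \<Rightarrow> nat"
  assumes graph: "simple_graph V E" and bip: "bipartite V E"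
    and inj_s: "inj_on s V" and inj_p: "inj_on p V"
    and edge_iff: "\<And>u v. u \<in> V \<Longrightarrow> v \<in> V \<Longrightarrow> s u < s v \<Longrightarrow> {u, v} \<in> E \<longleftrightarrow> p v < p u"
begin

text \<open>A vertex \<open>v\<close> is viewed as the point with coordinates \<open>s v\<close> and
  \<open>p v\<close>, and an edge is directed from its upper left to its lower right end.\<close>

definition above :: "'a \<Rightarrow> 'a \<Rightarrow> bool" where
  "above u l \<longleftrightarrow> u \<in> V \<and> l \<in> V \<and> s u < s l \<and> p l < p u"

lemma nbrs_iff: "v \<in> nbrs E u \<longleftrightarrow> above u v \<or> above v u"
proof
  assume v: "v \<in> nbrs E u"
  have uv: "v \<in> V" "u \<in> V" "u \<noteq> v"
    using v nbrs_sym[of v E u] nbrs_subset[OF graph, of u] nbrs_subset[OF graph, of v]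
      not_nbrs_self[OF graph, of u] by auto
  then have "s u < s v \<or> s v < s u" using inj_s by (meson inj_onD linorder_neqE_nat)
  then show "above u v \<or> above v u"
    using edge_iff[OF uv(2,1)] edge_iff[OF uv(1,2)] v uv
    by (auto simp: above_def nbrs_def insert_commute)
next
  show "above u v \<or> above v u \<Longrightarrow> v \<in> nbrs E u"
    using edge_iff[of u v] edge_iff[of v u] by (auto simp: above_def nbrs_def insert_commute)
qed

text \<open>Otherwise the diagram would contain three pairwise crossing segments, that is, a triangle.\<close>

lemma not_above_above: "above u v \<Longrightarrow> \<not> above v w"
proof
  assume uv: "above u v" and vw: "above v w"
  then have "above u w" by (auto simp: above_def)
  with uv vw have "v \<in> nbrs E u" "w \<in> nbrs E v" "w \<in> nbrs E u"
    using nbrs_iff by blast+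
  then show False using bipartite_nbrs[OF bip] by metis
qed

lemma lower_nbrs: "above u l \<Longrightarrow> v \<in> nbrs E l \<longleftrightarrow> above v l"
  using not_above_above nbrs_iff by blast

text \<open>Each of \<open>l\<close> and \<open>l'\<close> has a vertex above it, so neither is
  above the other; points not in inverted position are ordered alike by both coordinates.\<close>

lemma lower_order:
  assumes "above u l" "above u' l'"
  shows "s l \<le> s l' \<longleftrightarrow> p l \<le> p l'"
proof -
  have "\<not> above l l'" "\<not> above l' l" using assms not_above_above by blast+
  moreover have "s l = s l' \<longleftrightarrow> l = l'" "p l = p l' \<longleftrightarrow> l = l'"
    using assms inj_s inj_p by (auto simp: above_def inj_on_def)
  moreover have "l \<in> V" "l' \<in> V" using assms by (auto simp: above_def)
  ultimately show ?thesis unfolding above_def by linarith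
qed

definition extreme :: "('a \<times> 'a) set \<Rightarrow> 'a \<Rightarrow> 'a \<Rightarrow> bool" where
  "extreme Q x y \<longleftrightarrow> x \<in> snd ` Q \<and> y \<in> snd ` Q \<and> (\<forall>l \<in> snd ` Q. s x \<le> s l \<and> s l \<le> s y)"

lemma extreme_exists:
  assumes "finite Q" "Q \<noteq> {}"
  obtains x y where "extreme Q x y"
proof -
  have "finite (s ` snd ` Q)" "s ` snd ` Q \<noteq> {}" using assms by auto
  from Min_in[OF this] Max_in[OF this] obtain x y where
    "x \<in> snd ` Q" "s x = Min (s ` snd ` Q)" "y \<in> snd ` Q" "s y = Max (s ` snd ` Q)"
    by (metis imageE)
  then have "extreme Q x y" unfolding extreme_def using assms by auto
  then show thesis using that by blast
qed

text \<open>A common neighbour \<open>v\<close> of the extremes is above both, so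
  \<open>s v < s x \<le> s l\<close> and, by \<open>lower_order\<close>,
  \<open>p l \<le> p y < p v\<close>.\<close>

lemma extreme_common_nbrs:
  assumes "extreme Q x y" and ab: "\<forall>(u, l) \<in> Q. above u l" and l: "l \<in> snd ` Q"
  shows "common_nbrs E x y \<subseteq> nbrs E l"
proof
  fix v assume v: "v \<in> common_nbrs E x y"
  have "\<exists>u. above u b" if "b \<in> snd ` Q" for b using that ab by fastforce
  then obtain u u' u'' where q: "above u l" "above u' x" "above u'' y"
    using assms(1) l unfolding extreme_def by meson
  have "above v x" "above v y" using v q lower_nbrs by (auto simp: common_nbrs_def)
  moreover have "s x \<le> s l" "p l \<le> p y"
    using assms(1) l lower_order[OF q(1,3)] unfolding extreme_def by blast+
  ultimately have "above v l" using q(1) by (auto simp: above_def)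
  then show "v \<in> nbrs E l" using nbrs_iff by blast
qed

text \<open>\<open>Q\<close> holds the edges that remain, \<open>D\<close> the upper endpoints of
  the removed ones. Removing an edge moves its upper endpoint from \<open>Q\<close> to
  \<open>D\<close>, which preserves the sum \<open>k\<close>. The search runs against the direction
  of removal: the induction hypothesis for the smaller set gives the earlier level, and one
  \<open>step\<close> brings the removed edge back.\<close>

lemma level_of_clique_matching:
  assumes "finite Q" "Q \<noteq> {}" "\<forall>(u, l) \<in> Q. above u l" "inj_on snd Q"
    and "\<forall>(u, l) \<in> Q. \<forall>(u', l') \<in> Q. above u l' \<or> above u' l"
    and "finite D" "D \<inter> fst ` Q = {}" "\<forall>v \<in> D. \<forall>l \<in> snd ` Q. v \<in> nbrs E l"
    and "inj_on fst Q" and "k = card D + card Q" and "extreme Q x y"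
  shows "(x, y) \<in> level V E k (card Q - 1)"
  using assms
proof (induction "card Q - 1" arbitrary: Q D x y)
  case 0
  then obtain u l where Q: "Q = {(u, l)}"
    by (metis card_1_singletonE card_gt_0_iff diff_is_0_eq le_antisym less_eq_Suc_le One_nat_def
        surj_pair)
  then have xy: "x = l" "y = l" and "l \<in> V" "u \<notin> D" using 0 by (auto simp: extreme_def above_def)
  have "insert u D \<subseteq> nbrs E l"
    using 0 Q nbrs_iff by auto
  then have "card (insert u D) \<le> card (nbrs E l)"
    using card_mono finite_nbrs[OF graph] by metis
  then show ?case using 0 Q xy \<open>l \<in> V\<close> \<open>u \<notin> D\<close> by auto
next
  case (Suc c)
  obtain u1 u2 where u12: "(u1, x) \<in> Q" "(u2, y) \<in> Q"
    using Suc.prems(11) by (auto simp: extreme_def)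
  \<comment> \<open>The edges at \<open>x\<close> and at \<open>y\<close> are joined, so
    \<open>u1\<close> is also above \<open>y\<close> or \<open>u2\<close> is also above
    \<open>x\<close>; that vertex is adjacent to both extremes.\<close>
  obtain u l where ul: "(u, l) \<in> Q" and u: "u \<in> common_nbrs E x y"
  proof -
    have "above u1 y \<or> above u2 x" using Suc.prems(5) u12 by blast
    moreover have "above u1 x" "above u2 y" using Suc.prems(3) u12 by auto
    ultimately show thesis
      using that[OF u12(1)] that[OF u12(2)] nbrs_iff by (auto simp: common_nbrs_def)
  qed
  define Q' where "Q' = Q - {(u, l)}"
  define D' where "D' = insert u D"
  have cQ': "card Q' = Suc c" using Suc.hyps(2) ul Suc.prems(1) by (simp add: Q'_def)
  have "u \<notin> D" using ul Suc.prems(7) by force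
  have fQ: "finite Q'" "Q' \<noteq> {}" using cQ' by (auto intro: card_ge_0_finite)
  then obtain x' y' where e': "extreme Q' x' y'" using extreme_exists by blast
  have snd': "snd ` Q' = snd ` Q - {l}"
    using inj_on_image_set_diff[OF Suc.prems(4), of Q "{(u, l)}"] ul by (simp add: Q'_def)
  have fst': "u \<notin> fst ` Q'"
    using inj_on_image_set_diff[OF Suc.prems(9), of Q "{(u, l)}"] ul by (simp add: Q'_def)
  have cn: "D' \<subseteq> common_nbrs E x y"
    using Suc.prems(8,11) u unfolding D'_def extreme_def common_nbrs_def by blast
  have cnl: "common_nbrs E x y \<subseteq> nbrs E l'" if "l' \<in> snd ` Q" for l'
    using extreme_common_nbrs[OF Suc.prems(11,3) that] .
  have lev: "(x', y') \<in> level V E k c"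
  proof -
    have "(x', y') \<in> level V E k (card Q' - 1)"
    proof (rule Suc.hyps(1))
      show "c = card Q' - 1" using cQ' by simp
      show "\<forall>(u, l)\<in>Q'. above u l" "\<forall>(u, l)\<in>Q'. \<forall>(u', l')\<in>Q'. above u l' \<or> above u' l"
        "inj_on snd Q'" "inj_on fst Q'"
        using Suc.prems(3,4,5,9) unfolding Q'_def by (auto simp: inj_on_def)
      show "D' \<inter> fst ` Q' = {}"
        using Suc.prems(7) fst' unfolding D'_def Q'_def by auto
      show "\<forall>v\<in>D'. \<forall>l\<in>snd ` Q'. v \<in> nbrs E l"
        using cn cnl snd' by blast
      show "k = card D' + card Q'"
        using Suc.prems(6,10) Suc.hyps(2) cQ' \<open>u \<notin> D\<close> by (simp add: D'_def)
    qed (use e' fQ Suc.prems(6) in \<open>auto simp: D'_def\<close>)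
    then show ?thesis using cQ' by simp
  qed
  have sV: "snd ` Q \<subseteq> V" using Suc.prems(3) by (auto simp: above_def)
  have uniq: "a = b" if "a \<in> snd ` Q" "b \<in> snd ` Q" "s a = s b" for a b
    using that sV inj_s by (meson inj_onD subsetD)
  have ext: "x \<in> snd ` Q" "y \<in> snd ` Q" "\<And>a. a \<in> snd ` Q \<Longrightarrow> s x \<le> s a \<and> s a \<le> s y"
    using Suc.prems(11) unfolding extreme_def by blast+
  have ext': "x' \<in> snd ` Q - {l}" "y' \<in> snd ` Q - {l}"
    "\<And>a. a \<in> snd ` Q - {l} \<Longrightarrow> s x' \<le> s a \<and> s a \<le> s y'"
    using e' unfolding extreme_def snd' by blast+
  \<comment> \<open>Only \<open>l\<close> has left the lower endpoints, so an extreme different from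
    \<open>l\<close> remains extreme. Both extremes cannot be \<open>l\<close>, as some lower
    endpoint other than \<open>l\<close> remains.\<close>
  have shared: "x = x' \<or> y = y'"
  proof (cases "x = l \<and> y = l")
    case True
    then have "s x' = s l" using ext(3)[of x'] ext'(1) by auto
    then show ?thesis using uniq[of x' l] ext(1) ext'(1) True by auto
  next
    case False
    then show ?thesis
    proof (cases "x = l")
      case True
      then have "s y = s y'" using False ext(2) ext(3)[of y'] ext'(2) ext'(3)[of y] by auto
      then show ?thesis using uniq[of y y'] ext(2) ext'(2) by auto
    next
      case False
      then have "s x = s x'" using ext(1) ext(3)[of x'] ext'(1) ext'(3)[of x] by auto
      then show ?thesis using uniq[of x x'] ext(1) ext'(1) by auto
    qed
  qed
  have "snd ` Q' \<subseteq> closure V E x' y'"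
  proof
    fix a assume a: "a \<in> snd ` Q'"
    have "\<forall>(u, l)\<in>Q'. above u l" using Suc.prems(3) by (auto simp: Q'_def)
    from extreme_common_nbrs[OF e' this a] show "a \<in> closure V E x' y'"
      using a sV snd' by (auto simp: closure_def)
  qed
  then have "card (snd ` Q') \<le> card (closure V E x' y')"
    using card_mono finite_closure[OF graph] by metis
  moreover have "card (snd ` Q') = Suc c"
    using Suc.prems(4) cQ' by (metis Q'_def card_image inj_on_diff)
  moreover have "card D' \<le> card (common_nbrs E x y)"
    using cn card_mono finite_common_nbrs[OF graph] by metis
  moreover have "card D' = Suc (card D)" using \<open>u \<notin> D\<close> Suc.prems(6) by (simp add: D'_def)
  moreover have "k = card D + Suc (Suc c)" using Suc.prems(10) Suc.hyps(2) by simp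
  \<comment> \<open>The two lower bounds \<open>c + 1\<close> and \<open>card D + 1\<close> sum to
    exactly \<open>k\<close>.\<close>
  ultimately have large: "k \<le> card (closure V E x' y') + card (common_nbrs E x y)" by simp
  have sub: "common_nbrs E x y \<subseteq> nbrs E x'" "common_nbrs E x y \<subseteq> nbrs E y'"
    using cnl e' snd' by (auto simp: extreme_def)
  have xyV: "x \<in> V" "y \<in> V" using Suc.prems(11) sV by (auto simp: extreme_def)
  have ne: "common_nbrs E x y \<noteq> {}" using u by auto
  have "(x, y) \<in> level V E k (Suc c)"
    using shared
  proof
    assume "x = x'"
    then have "step V E k x' y' y" using xyV ne sub large by (simp add: step_def)
    with lev \<open>x = x'\<close> show ?thesis by auto
  next
    assume "y = y'"
    \<comment> \<open>Here the first component changes, so the step starts from the mirrored pair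
      \<open>(y', x')\<close>.\<close>
    then have "step V E k y' x' x" using xyV ne sub large
      by (simp add: step_def common_nbrs_commute closure_commute)
    with level_commute[OF lev] \<open>y = y'\<close> show ?thesis by auto
  qed
  then show ?case using Suc.hyps(2) by simp
qed

text \<open>The level reached is \<open>k - 1\<close>. Since the \<open>k\<close> matching edges lie
  in \<open>E\<close>, it is below \<open>card E\<close>, which bounds the number of rounds the
  program needs.\<close>

lemma level_complete:
  assumes "has_clique_matching E k" "k \<ge> 1"
  shows "\<exists>r < card E. \<exists>(x, y) \<in> level V E k r. k \<le> card (closure V E x y)"
proof -
  have finE: "finite E"
    using graph finite_subset[of E "Pow V"] by (auto simp: simple_graph_def)
  obtain M0 where M0: "clique_matching E M0" "k \<le> card M0"
    using assms by (auto simp: has_clique_matching_def)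
  \<comment> \<open>Exactly \<open>k\<close> edges are kept, so that the descent can start with
    \<open>D = {}\<close> and \<open>k = card D + card Q\<close>.\<close>
  then obtain M where M: "M \<subseteq> M0" "card M = k" by (meson obtain_subset_with_card_n)
  have ME: "M \<subseteq> E"
    using M0(1) M(1) by (auto simp: clique_matching_def matching_def)
  have disj: "e1 \<inter> e2 = {}" if "e1 \<in> M" "e2 \<in> M" "e1 \<noteq> e2" for e1 e2
    using M0(1) M(1) that by (auto simp: clique_matching_def matching_def subset_iff)
  have join: "\<exists>u\<in>e1. \<exists>v\<in>e2. v \<in> nbrs E u" if "e1 \<in> M" "e2 \<in> M" "e1 \<noteq> e2" for e1 e2
    using M0(1) M(1) that by (auto simp: clique_matching_def nbrs_def subset_iff)
  define Q where "Q = {(u, l). above u l \<and> {u, l} \<in> M}"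
  have QM: "bij_betw (\<lambda>(u, l). {u, l}) Q M"
  proof (rule bij_betw_imageI)
    show "inj_on (\<lambda>(u, l). {u, l}) Q"
      by (auto simp: inj_on_def Q_def above_def doubleton_eq_iff)
    show "(\<lambda>(u, l). {u, l}) ` Q = M"
    proof
      show "M \<subseteq> (\<lambda>(u, l). {u, l}) ` Q"
      proof
        fix e assume e: "e \<in> M"
        then obtain a b where ab: "e = {a, b}"
          using ME graph unfolding simple_graph_def card_2_iff by (meson subsetD)
        then have "b \<in> nbrs E a" using e ME by (auto simp: nbrs_def)
        then have "(a, b) \<in> Q \<or> (b, a) \<in> Q"
          using e ab nbrs_iff by (auto simp: Q_def insert_commute)
        then show "e \<in> (\<lambda>(u, l). {u, l}) ` Q"
          unfolding ab using insert_commute[of a b "{}"] by (auto intro: rev_image_eqI)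
      qed
    qed (auto simp: Q_def)
  qed
  have cQ: "card Q = k" using bij_betw_same_card[OF QM] M(2) by simp
  then have fQ: "finite Q" "Q \<noteq> {}" using assms(2) by (auto intro: card_ge_0_finite)
  have ab: "\<forall>(u, l) \<in> Q. above u l" by (auto simp: Q_def)
  have eq: "(u, l) = (u', l')" if "(u, l) \<in> Q" "(u', l') \<in> Q" "u = u' \<or> l = l'" for u l u' l'
  proof -
    have "{u, l} \<inter> {u', l'} \<noteq> {}" "{u, l} \<in> M" "{u', l'} \<in> M" "above u l" "above u' l'"
      using that unfolding Q_def by auto
    then have "{u, l} = {u', l'}" using disj by metis
    then show ?thesis
      using \<open>above u l\<close> \<open>above u' l'\<close> by (auto simp: above_def doubleton_eq_iff)
  qed
  have inj: "inj_on fst Q" "inj_on snd Q"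
    unfolding inj_on_def by (metis eq prod.collapse)+
  have joined: "\<forall>(u, l) \<in> Q. \<forall>(u', l') \<in> Q. above u l' \<or> above u' l"
  proof (clarify)
    fix u l u' l'
    assume q: "(u, l) \<in> Q" "(u', l') \<in> Q" and n: "\<not> above u' l"
    have abv: "above u l" "above u' l'" using q ab by auto
    show "above u l'"
    proof (cases "{u, l} = {u', l'}")
      case True
      then show ?thesis using abv by (auto simp: above_def doubleton_eq_iff)
    next
      case False
      have "{u, l} \<in> M" "{u', l'} \<in> M" using q by (simp_all add: Q_def)
      \<comment> \<open>Of these eight cases only \<open>above u l'\<close> and
        \<open>above u' l\<close> survive: any other would continue an edge of the matching to a
        chain of two \<open>above\<close> steps.\<close>
      from join[OF this False] have "above u u' \<or> above u' u \<or> above u l' \<or> above l' u \<or>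
          above l u' \<or> above u' l \<or> above l l' \<or> above l' l"
        using nbrs_iff by blast
      then show ?thesis using n abv not_above_above by metis
    qed
  qed
  obtain x y where xy: "extreme Q x y" using extreme_exists fQ by blast
  have "(x, y) \<in> level V E k (card Q - 1)"
    by (rule level_of_clique_matching[OF fQ ab inj(2) joined finite.emptyI _ _ inj(1) _ xy])
      (use cQ in auto)
  moreover have "k \<le> card E" using M ME finE card_mono by blast
  moreover have "k \<le> card (closure V E x y)"
  proof -
    have "snd ` Q \<subseteq> closure V E x y"
      using extreme_common_nbrs[OF xy ab] ab by (fastforce simp: closure_def above_def)
    then show ?thesis using card_mono finite_closure[OF graph] card_image inj(2) cQ by metis
  qed
  ultimately show ?thesis
    using cQ assms(2) by (intro exI[of _ "k - 1"]) auto
qed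

end

lemma has_clique_matching_level:
  assumes G: "bipartite_permutation_graph V E" and M: "has_clique_matching E k" and k: "k \<ge> 1"
  shows "\<exists>r < card E. \<exists>(x, y) \<in> level V E k r. k \<le> card (closure V E x y)"
proof -
  have g: "simple_graph V E" "bipartite V E" "permutation_graph V E"
    using G by (auto simp: bipartite_permutation_graph_def)
  then obtain \<sigma> \<pi> where sp: "bij_betw \<sigma> V {1..card V}" "\<pi> permutes {1..card V}"
    "\<forall>u\<in>V. \<forall>v\<in>V. \<sigma> u < \<sigma> v \<longrightarrow> ({u, v} \<in> E \<longleftrightarrow> \<pi> (\<sigma> u) > \<pi> (\<sigma> v))"
    unfolding permutation_graph_def by blast
  interpret permutation_diagram V E \<sigma> "\<lambda>v. \<pi> (\<sigma> v)"
    using g sp by unfold_locales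
      (auto simp: bij_betw_def inj_on_def dest!: permutes_inj)
  show ?thesis using level_complete[OF M k] .
qed

section \<open>Running time of structured programs\<close>

text \<open>A total-correctness triple with a time bound; as \<open>exec\<close> is deterministic,
  the final state is the only one.\<close>

definition runs :: "com \<Rightarrow> state \<Rightarrow> nat \<Rightarrow> (state \<Rightarrow> bool) \<Rightarrow> bool" where
  "runs c s T Q \<longleftrightarrow> (\<exists>t s'. exec c s t s' \<and> t \<le> T \<and> Q s')"

lemma runs_mono:
  "runs c s T Q \<Longrightarrow> T \<le> T' \<Longrightarrow> (\<And>s'. Q s' \<Longrightarrow> Q' s') \<Longrightarrow> runs c s T' Q'"
  unfolding runs_def by (meson le_trans)

lemma runs_le: "runs c s T Q \<Longrightarrow> T \<le> T' \<Longrightarrow> runs c s T' Q"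
  by (rule runs_mono)

lemma runs_Skip: "Q s \<Longrightarrow> runs Skip s 1 Q"
  unfolding runs_def using exec.Skip by blast

lemma runs_Assign:
  "Q (store s x (aval i s) (aval a s)) \<Longrightarrow> acost i + acost a + 1 \<le> T \<Longrightarrow> runs (Assign x i a) s T Q"
  unfolding runs_def using exec.Assign by blast

lemma runs_Seq:
  assumes "runs c1 s T1 P" "\<And>s'. P s' \<Longrightarrow> runs c2 s' T2 Q"
  shows "runs (Seq c1 c2) s (T1 + T2 + 1) Q"
proof -
  obtain t1 s1 where 1: "exec c1 s t1 s1" "t1 \<le> T1" "P s1"
    using assms(1) by (auto simp: runs_def)
  obtain t2 s2 where 2: "exec c2 s1 t2 s2" "t2 \<le> T2" "Q s2"
    using assms(2)[OF 1(3)] by (auto simp: runs_def)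
  from exec.Seq[OF 1(1) 2(1)] 1 2 show ?thesis
    unfolding runs_def by (intro exI[of _ "t1 + t2 + 1"] exI[of _ s2]) simp
qed

lemma runs_Cond:
  assumes "bval b s \<Longrightarrow> runs c1 s T Q" "\<not> bval b s \<Longrightarrow> runs c2 s T Q" "bcost b + T + 1 \<le> T'"
  shows "runs (Cond b c1 c2) s T' Q"
proof -
  have "\<exists>t s'. exec (Cond b c1 c2) s (bcost b + t + 1) s' \<and> t \<le> T \<and> Q s'"
    using assms(1,2) exec.CondTrue exec.CondFalse unfolding runs_def by (cases "bval b s") blast+
  then obtain t s' where "exec (Cond b c1 c2) s (bcost b + t + 1) s'" "t \<le> T" "Q s'" by blast
  moreover from this have "bcost b + t + 1 \<le> T'" using assms(3) by simp
  ultimately show ?thesis unfolding runs_def by blast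
qed

abbreviation Var :: "string \<Rightarrow> aexp" where
  "Var x \<equiv> Cell x (Const 0)"

definition For :: "string \<Rightarrow> string \<Rightarrow> com \<Rightarrow> com" where
  "For i lim body = Seq (Assign i (Const 0) (Const 0))
     (While (Less (Var i) (Var lim)) (Seq body (Assign i (Const 0) (Plus (Var i) (Const 1)))))"

text \<open>The invariant is demanded after the increment, and the body must leave the counter
  alone. An iteration costs at most \<open>T + 13\<close>; initialisation, final test and sequencing
  cost \<open>10\<close>, absorbed by the first of the \<open>N \<ge> 1\<close> iterations.\<close>

lemma runs_For:
  assumes N: "1 \<le> N"
    and init: "I 0 (store s i 0 0)"
    and counter: "\<And>j s. I j s \<Longrightarrow> s i 0 = j \<and> s lim 0 = N"
    and body: "\<And>j s. j < N \<Longrightarrow> I j s \<Longrightarrow>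
      runs body s T (\<lambda>s'. s' i 0 = j \<and> I (Suc j) (store s' i 0 (Suc j)))"
    and final: "\<And>s'. I N s' \<Longrightarrow> Q s'"
  shows "runs (For i lim body) s ((T + 23) * N) Q"
proof -
  define w where
    "w = While (Less (Var i) (Var lim)) (Seq body (Assign i (Const 0) (Plus (Var i) (Const 1))))"
  \<comment> \<open>Induction on the number \<open>d\<close> of iterations still to come;
    \<open>6\<close> is the cost of the failing test.\<close>
  have loop: "runs w s ((T + 13) * d + 6) (I N)" if "I j s" "j + d = N" for j d s
    using that
  proof (induction d arbitrary: j s)
    case 0
    then have "\<not> bval (Less (Var i) (Var lim)) s" using counter[OF 0(1)] by simp
    then have "exec w s (bcost (Less (Var i) (Var lim)) + 1) s"
      unfolding w_def by (rule exec.WhileFalse)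
    moreover have "bcost (Less (Var i) (Var lim)) + 1 \<le> (T + 13) * 0 + 6" by simp
    moreover have "I N s" using 0 by simp
    ultimately show ?case unfolding runs_def by blast
  next
    case (Suc d)
    have b: "bval (Less (Var i) (Var lim)) s" using counter[OF Suc.prems(1)] Suc.prems(2) by simp
    have "runs (Seq body (Assign i (Const 0) (Plus (Var i) (Const 1)))) s (T + 6 + 1) (I (Suc j))"
      by (rule runs_Seq[OF body[OF _ Suc.prems(1)]], use Suc.prems(2) in simp, rule runs_Assign)
        auto
    then obtain t1 s1 where 1:
      "exec (Seq body (Assign i (Const 0) (Plus (Var i) (Const 1)))) s t1 s1" "t1 \<le> T + 7"
      "I (Suc j) s1" by (auto simp: runs_def)
    from Suc.IH[OF 1(3)] Suc.prems(2) obtain t2 s2 where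
      2: "exec w s1 t2 s2" "t2 \<le> (T + 13) * d + 6" "I N s2" by (auto simp: runs_def)
    from exec.WhileTrue[OF b 1(1) 2(1)[unfolded w_def], folded w_def] 1(2) 2(2,3)
    show ?case unfolding runs_def by (intro exI conjI) auto
  qed
  have "runs (For i lim body) s (3 + ((T + 13) * N + 6) + 1) (I N)"
    unfolding For_def w_def[symmetric]
    by (rule runs_Seq[OF runs_Assign[where Q = "I 0"] loop]) (use init in auto)
  moreover have "3 + ((T + 13) * N + 6) + 1 \<le> (T + 23) * N"
    using N by (simp add: algebra_simps)
  ultimately show ?thesis using final by (rule runs_mono)
qed

definition Count :: "string \<Rightarrow> string \<Rightarrow> bexp \<Rightarrow> com" where
  "Count c u b = Seq (Assign c (Const 0) (Const 0))
     (For u ''n'' (Cond b (Assign c (Const 0) (Plus (Var c) (Const 1))) Skip))"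

lemma store_apply: "store s x i v y = (if y = x then (s x)(i := v) else s y)"
  by (simp add: store_def)

text \<open>Premise \<open>b\<close> ranges over all values \<open>cv\<close> of the counter, so the
  test cannot depend on the count so far. Only counter and loop variable change, hence
  \<open>Q\<close> is asked of a single explicit state.\<close>

lemma runs_Count:
  assumes "c \<noteq> u" "c \<noteq> ''n''" "u \<noteq> ''n''" "s ''n'' 0 = n" "1 \<le> n"
    and b: "\<And>v cv. v < n \<Longrightarrow> bval b (store (store s c 0 cv) u 0 v) \<longleftrightarrow> \<phi> v"
    and Q: "Q (store (store s c 0 (card {v. v < n \<and> \<phi> v})) u 0 n)"
  shows "runs (Count c u b) s ((bcost b + 40) * n) Q"
proof -
  define I where "I j s' \<longleftrightarrow> s' = store (store s c 0 (card {v. v < j \<and> \<phi> v})) u 0 j" for j s'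
  have count: "card {v. v < Suc j \<and> \<phi> v} = card {v. v < j \<and> \<phi> v} + (if \<phi> j then 1 else 0)" for j
  proof -
    have "{v. v < Suc j \<and> \<phi> v} = (if \<phi> j then insert j {v. v < j \<and> \<phi> v} else {v. v < j \<and> \<phi> v})"
      by (auto simp: less_Suc_eq)
    then show ?thesis by simp
  qed
  have loop: "runs (For u ''n'' (Cond b (Assign c (Const 0) (Plus (Var c) (Const 1))) Skip))
      (store s c 0 0) ((bcost b + 7 + 23) * n) Q"
  proof (rule runs_For[where I = I, OF assms(5)])
    fix j s' assume j: "j < n" "I j s'"
    then have bj: "bval b s' \<longleftrightarrow> \<phi> j" using b by (simp add: I_def)
    show "runs (Cond b (Assign c (Const 0) (Plus (Var c) (Const 1))) Skip) s' (bcost b + 7)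
        (\<lambda>s'. s' u 0 = j \<and> I (Suc j) (store s' u 0 (Suc j)))"
    proof (rule runs_Cond[where T = 6])
      assume "bval b s'"
      then show "runs (Assign c (Const 0) (Plus (Var c) (Const 1))) s' 6
        (\<lambda>s'. s' u 0 = j \<and> I (Suc j) (store s' u 0 (Suc j)))"
        using j bj assms(1) count[of j]
        by (intro runs_Assign) (auto simp: I_def store_def fun_eq_iff)
    next
      assume "\<not> bval b s'"
      then show "runs Skip s' 6 (\<lambda>s'. s' u 0 = j \<and> I (Suc j) (store s' u 0 (Suc j)))"
        using j bj assms(1) count[of j]
        by (intro runs_le[OF runs_Skip]) (auto simp: I_def store_def fun_eq_iff)
    qed simp
  next
    show "I 0 (store (store s c 0 0) u 0 0)" by (simp add: I_def)
  qed (use assms in \<open>auto simp: I_def store_apply\<close>)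
  have "runs (Count c u b) s (3 + ((bcost b + 7 + 23) * n) + 1) Q"
    unfolding Count_def
    by (rule runs_Seq[where P = "\<lambda>s'. s' = store s c 0 0"], rule runs_Assign)
      (use loop in simp_all)
  then show ?thesis using \<open>1 \<le> n\<close> by (elim runs_le) (simp add: algebra_simps)
qed

section \<open>The program\<close>

text \<open>A row-major adjacency matrix whose row offsets are looked up, since the machine cannot
  multiply.\<close>

definition Adj :: "string \<Rightarrow> string \<Rightarrow> bexp" where
  "Adj x u = Equal (Cell ''adj'' (Plus (Cell ''row'' (Var x)) (Var u))) (Const 1)"

text \<open>The variable \<open>b\<close> holds the size of the closure of \<open>(x, y)\<close>, \<open>c\<close> the number of common
  neighbours of \<open>x\<close> and \<open>z\<close>, and \<open>d\<close> counts the violations of an inclusion of neighbourhoods.\<close>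

definition Closure :: com where
  "Closure = Seq (Assign ''b'' (Const 0) (Const 0))
     (For ''z'' ''n''
       (Seq (Count ''d'' ''u'' (And (And (Adj ''x'' ''u'') (Adj ''y'' ''u'')) (Neg (Adj ''z'' ''u''))))
         (Cond (Equal (Var ''d'') (Const 0))
           (Assign ''b'' (Const 0) (Plus (Var ''b'') (Const 1))) Skip)))"

definition Mark :: "string \<Rightarrow> string \<Rightarrow> com" where
  "Mark x y = Assign ''R'' (Plus (Cell ''row'' (Var x)) (Var y)) (Const 1)"

definition Successors :: com where
  "Successors = For ''z'' ''n''
     (Seq (Count ''d'' ''u'' (And (And (Adj ''x'' ''u'') (Adj ''z'' ''u'')) (Neg (Adj ''y'' ''u''))))
       (Seq (Count ''c'' ''u'' (And (Adj ''x'' ''u'') (Adj ''z'' ''u'')))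
         (Cond (And (And (Equal (Var ''d'') (Const 0)) (Less (Const 0) (Var ''c'')))
                 (Neg (Less (Plus (Var ''b'') (Var ''c'')) (Var ''k''))))
           (Seq (Mark ''x'' ''z'') (Mark ''z'' ''x'')) Skip)))"

definition Visit :: com where
  "Visit = Cond (Equal (Cell ''R'' (Plus (Cell ''row'' (Var ''x'')) (Var ''y''))) (Const 1))
     (Seq Closure
       (Seq (Cond (Neg (Less (Var ''b'') (Var ''k''))) (Assign ''ans'' (Const 0) (Const 1)) Skip)
         Successors))
     Skip"

definition Rounds :: com where
  "Rounds = For ''r'' ''m'' (For ''x'' ''n'' (For ''y'' ''n'' Visit))"

definition Start :: com where
  "Start = For ''x'' ''n'' (Seq (Count ''c'' ''u'' (Adj ''x'' ''u''))
     (Cond (Neg (Less (Var ''c'') (Var ''k''))) (Mark ''x'' ''x'') Skip))"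

text \<open>The multiples of \<open>n\<close>, tabulated once by repeated addition.\<close>

definition Rows :: com where
  "Rows = For ''u'' ''n'' (Assign ''row'' (Plus (Var ''u'') (Const 1))
     (Plus (Cell ''row'' (Var ''u'')) (Var ''n'')))"

definition Set_adj :: "string \<Rightarrow> string \<Rightarrow> com" where
  "Set_adj a b = Assign ''adj''
     (Plus (Cell ''row'' (Cell a (Var ''r''))) (Cell b (Var ''r''))) (Const 1)"

definition Edges :: com where
  "Edges = For ''r'' ''m'' (Seq (Set_adj ''src'' ''dst'') (Set_adj ''dst'' ''src''))"

text \<open>Without edges the answer is no and \<open>ans\<close> is already \<open>0\<close>. The
  test also ensures that every loop runs at least once, as \<open>runs_For\<close> requires.\<close>

definition clique_matching_program :: com where
  "clique_matching_program = Cond (Less (Const 0) (Var ''m''))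
     (Seq Rows (Seq Edges (Seq Start Rounds))) Skip"

section \<open>Frame conditions and row-major indices\<close>

definition agree :: "string set \<Rightarrow> state \<Rightarrow> state \<Rightarrow> bool" where
  "agree X s s' \<longleftrightarrow> (\<forall>x. x \<notin> X \<longrightarrow> s' x = s x)"

lemma agreeD: "agree X s s' \<Longrightarrow> x \<notin> X \<Longrightarrow> s' x = s x"
  by (simp add: agree_def)

lemma agree_refl: "agree X s s"
  by (simp add: agree_def)

lemma agree_store: "agree X s s' \<Longrightarrow> x \<in> X \<Longrightarrow> agree X s (store s' x i v)"
  by (auto simp: agree_def store_apply)

lemma index_eq_iff:
  fixes y y' n :: nat
  assumes "y < n" "y' < n"
  shows "x * n + y = x' * n + y' \<longleftrightarrow> x = x' \<and> y = y'"
proof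
  assume eq: "x * n + y = x' * n + y'"
  have "(x * n + y) div n = x" "(x' * n + y') div n = x'" using assms by simp_all
  then show "x = x' \<and> y = y'" using eq by simp
qed simp

section \<open>Effect and cost of the search on a fixed instance with edges\<close>

locale ram_instance =
  fixes n m k :: nat and E :: "nat set set"
  assumes graph: "simple_graph {0..<n} E" and n: "1 \<le> n" and m: "1 \<le> m"
begin

abbreviation "cl \<equiv> closure {0..<n} E"

definition inst :: "state \<Rightarrow> bool" where
  "inst s \<longleftrightarrow> s ''n'' 0 = n \<and> s ''m'' 0 = m \<and> s ''k'' 0 = k \<and> (\<forall>i\<le>n. s ''row'' i = i * n) \<and>
     (\<forall>x<n. \<forall>y<n. s ''adj'' (x * n + y) = 1 \<longleftrightarrow> {x, y} \<in> E)"

definition marked :: "state \<Rightarrow> (nat \<times> nat) set" where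
  "marked s = {(x, y). x < n \<and> y < n \<and> s ''R'' (x * n + y) = 1}"

definition successors :: "nat \<Rightarrow> nat \<Rightarrow> (nat \<times> nat) set" where
  "successors x y = {q. \<exists>z. step {0..<n} E k x y z \<and> (q = (x, z) \<or> q = (z, x))}"

lemma inst_store [simp]:
  assumes "x \<notin> {''n'', ''m'', ''k'', ''row'', ''adj''}"
  shows "inst (store s x i v) = inst s"
proof -
  have "store s x i v ''n'' = s ''n''" "store s x i v ''m'' = s ''m''" "store s x i v ''k'' = s ''k''"
    "store s x i v ''row'' = s ''row''" "store s x i v ''adj'' = s ''adj''"
    using assms by (auto simp: store_apply)
  then show ?thesis by (simp add: inst_def)
qed

lemma marked_store [simp]: "x \<noteq> ''R'' \<Longrightarrow> marked (store s x i v) = marked s"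
  by (simp add: marked_def store_apply)

lemma inst_agree:
  assumes "agree X s s'" "inst s" "X \<inter> {''n'', ''m'', ''k'', ''row'', ''adj''} = {}"
  shows "inst s'"
proof -
  have "s' ''n'' = s ''n''" "s' ''m'' = s ''m''" "s' ''k'' = s ''k''" "s' ''row'' = s ''row''"
    "s' ''adj'' = s ''adj''"
    using assms(1,3) by (auto simp: agree_def)
  then show ?thesis using assms(2) by (simp add: inst_def)
qed

lemma marked_agree: "agree X s s' \<Longrightarrow> ''R'' \<notin> X \<Longrightarrow> marked s' = marked s"
  by (simp add: agree_def marked_def)

lemma marked_insert:
  assumes "x < n" "y < n"
  shows "marked (store s ''R'' (x * n + y) 1) = insert (x, y) (marked s)"
  using assms index_eq_iff[where n = n] by (auto simp: marked_def store_apply)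

lemma inst_vars: "inst s \<Longrightarrow> s ''n'' 0 = n \<and> s ''m'' 0 = m \<and> s ''k'' 0 = k"
  by (simp add: inst_def)

lemma inst_row: "inst s \<Longrightarrow> x < n \<Longrightarrow> s ''row'' x = x * n"
  by (simp add: inst_def)

lemma bval_Adj: "inst s \<Longrightarrow> s x 0 < n \<Longrightarrow> s u 0 < n \<Longrightarrow> bval (Adj x u) s \<longleftrightarrow> s u 0 \<in> nbrs E (s x 0)"
  by (simp add: Adj_def inst_def nbrs_def)

lemma nbrs_less: "u \<in> nbrs E x \<Longrightarrow> u < n"
  using nbrs_subset[OF graph] by fastforce

lemma runs_Mark:
  assumes "inst s" "s x 0 < n" "s y 0 < n"
    and "Q (store s ''R'' (s x 0 * n + s y 0) 1)"
  shows "runs (Mark x y) s 8 Q"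
  unfolding Mark_def using assms by (intro runs_Assign) (simp_all add: inst_row)

text \<open>Each of the \<open>n\<close> candidates costs one count over all vertices; the test of
  that count costs \<open>30\<close>, which with the overhead \<open>40\<close> gives
  \<open>70 * n\<close>.\<close>

lemma runs_Closure:
  assumes s: "inst s" "s ''x'' 0 = x" "s ''y'' 0 = y" "x < n" "y < n"
  shows "runs Closure s (110 * n ^ 2)
    (\<lambda>s'. agree {''b'', ''d'', ''u'', ''z''} s s' \<and> s' ''b'' 0 = card (cl x y))"
proof -
  define X where "X = {''b'', ''d'', ''u'', ''z''}"
  define I where "I j s' \<longleftrightarrow> agree X s s' \<and> s' ''z'' 0 = j \<and> s' ''b'' 0 = card {z \<in> cl x y. z < j}"
    for j s'
  have count: "card {z \<in> cl x y. z < Suc j} = card {z \<in> cl x y. z < j} + (if j \<in> cl x y then 1 else 0)"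
    for j
  proof -
    have "{z \<in> cl x y. z < Suc j} = {z \<in> cl x y. z < j} \<union> (if j \<in> cl x y then {j} else {})"
      by (auto simp: less_Suc_eq)
    then show ?thesis by (auto simp: card_insert_if)
  qed
  have loop: "runs (For ''z'' ''n''
      (Seq (Count ''d'' ''u'' (And (And (Adj ''x'' ''u'') (Adj ''y'' ''u'')) (Neg (Adj ''z'' ''u''))))
         (Cond (Equal (Var ''d'') (Const 0))
           (Assign ''b'' (Const 0) (Plus (Var ''b'') (Const 1))) Skip)))
     (store s ''b'' 0 0) ((70 * n + 12 + 23) * n)
     (\<lambda>s'. agree X s s' \<and> s' ''b'' 0 = card (cl x y))"
  proof (rule runs_For[where I = I, OF n])
    show "I 0 (store (store s ''b'' 0 0) ''z'' 0 0)"
      by (auto simp: I_def X_def store_apply intro!: agree_store agree_refl)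
  next
    fix j s' assume j: "j < n" "I j s'"
    define P where "P s'' \<longleftrightarrow> agree X s s'' \<and> s'' ''z'' 0 = j \<and> s'' ''b'' 0 = card {z \<in> cl x y. z < j} \<and>
      (s'' ''d'' 0 = 0 \<longleftrightarrow> j \<in> cl x y)" for s''
    have i': "inst s'" "s' ''x'' 0 = x" "s' ''y'' 0 = y" "s' ''z'' 0 = j"
      using j(2) s inst_agree[of X s s'] by (auto simp: I_def X_def agree_def)
    \<comment> \<open>No violation among the vertices below \<open>n\<close> means the inclusion, as
      all neighbours are below \<open>n\<close>.\<close>
    have iff: "card {v. v < n \<and> v \<in> nbrs E x \<and> v \<in> nbrs E y \<and> v \<notin> nbrs E j} = 0 \<longleftrightarrow> j \<in> cl x y"
      using j(1) nbrs_less by (auto simp: closure_def common_nbrs_def)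
    have "runs (Count ''d'' ''u'' (And (And (Adj ''x'' ''u'') (Adj ''y'' ''u'')) (Neg (Adj ''z'' ''u''))))
      s' ((bcost (And (And (Adj ''x'' ''u'') (Adj ''y'' ''u'')) (Neg (Adj ''z'' ''u''))) + 40) * n) P"
    proof (rule runs_Count[where \<phi> = "\<lambda>v. v \<in> nbrs E x \<and> v \<in> nbrs E y \<and> v \<notin> nbrs E j"])
      show "s' ''n'' 0 = n" using i'(1) inst_vars by blast
      show "P (store (store s' ''d'' 0
          (card {v. v < n \<and> v \<in> nbrs E x \<and> v \<in> nbrs E y \<and> v \<notin> nbrs E j})) ''u'' 0 n)"
        using j(2) iff unfolding P_def I_def
        by (auto simp: store_apply X_def intro!: agree_store)
    qed (use i' j s n in \<open>auto simp: bval_Adj store_apply\<close>)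
    then have 1: "runs (Count ''d'' ''u'' (And (And (Adj ''x'' ''u'') (Adj ''y'' ''u'')) (Neg (Adj ''z'' ''u''))))
      s' (70 * n) P" by (simp add: Adj_def)
    have 2: "runs (Cond (Equal (Var ''d'') (Const 0))
           (Assign ''b'' (Const 0) (Plus (Var ''b'') (Const 1))) Skip) s'' 11
       (\<lambda>s'. s' ''z'' 0 = j \<and> I (Suc j) (store s' ''z'' 0 (Suc j)))" if "P s''" for s''
      using that count[of j] unfolding P_def
      by (intro runs_Cond[where T = 6] runs_Assign runs_le[OF runs_Skip])
        (auto simp: I_def store_apply X_def intro!: agree_store)
    show "runs (Seq (Count ''d'' ''u'' (And (And (Adj ''x'' ''u'') (Adj ''y'' ''u'')) (Neg (Adj ''z'' ''u''))))
         (Cond (Equal (Var ''d'') (Const 0))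
           (Assign ''b'' (Const 0) (Plus (Var ''b'') (Const 1))) Skip)) s' (70 * n + 12)
       (\<lambda>s'. s' ''z'' 0 = j \<and> I (Suc j) (store s' ''z'' 0 (Suc j)))"
      by (rule runs_le[OF runs_Seq[OF 1 2]]) simp_all
  next
    fix j s' assume "I j s'"
    then show "s' ''z'' 0 = j \<and> s' ''n'' 0 = n"
      using s(1) agreeD[of X s s' "''n''"] by (auto simp: I_def X_def inst_vars)
  next
    fix s' assume "I n s'"
    moreover have "{z \<in> cl x y. z < n} = cl x y" by (auto simp: closure_def)
    ultimately show "agree X s s' \<and> s' ''b'' 0 = card (cl x y)" by (simp add: I_def)
  qed
  have "runs Closure s (3 + (70 * n + 12 + 23) * n + 1)
      (\<lambda>s'. agree X s s' \<and> s' ''b'' 0 = card (cl x y))"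
    unfolding Closure_def
    by (rule runs_Seq[where P = "\<lambda>s'. s' = store s ''b'' 0 0"], rule runs_Assign)
      (use loop in simp_all)
  moreover have "3 + (70 * n + 12 + 23) * n + 1 \<le> 110 * n ^ 2"
  proof -
    have "1 \<le> n * n" "n \<le> n * n" using n by simp_all
    moreover have "3 + (70 * n + 12 + 23) * n + 1 = 70 * (n * n) + 35 * n + 4"
      by (simp add: algebra_simps)
    ultimately show ?thesis unfolding power2_eq_square by linarith
  qed
  ultimately show ?thesis unfolding X_def by (rule runs_le)
qed

text \<open>The closure size in \<open>b\<close> survives the loop, because \<open>b\<close> is
  outside the arrays that change. So two counts per \<open>z\<close>, for \<open>d\<close> and for
  \<open>c\<close>, decide \<open>step\<close>.\<close>

lemma runs_Successors:
  assumes s: "inst s" "s ''x'' 0 = x" "s ''y'' 0 = y" "x < n" "y < n" "s ''b'' 0 = card (cl x y)"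
  shows "runs Successors s (191 * n ^ 2)
    (\<lambda>s'. agree {''c'', ''d'', ''u'', ''z'', ''R''} s s' \<and> marked s' = marked s \<union> successors x y)"
proof -
  define X where "X = {''c'', ''d'', ''u'', ''z'', ''R''}"
  define S where "S j = {q. \<exists>z<j. step {0..<n} E k x y z \<and> (q = (x, z) \<or> q = (z, x))}" for j
  define I where "I j s' \<longleftrightarrow> agree X s s' \<and> s' ''z'' 0 = j \<and> marked s' = marked s \<union> S j" for j s'
  have S_Suc: "S (Suc j) = (if step {0..<n} E k x y j then insert (x, j) (insert (j, x) (S j)) else S j)"
    for j by (auto simp: S_def less_Suc_eq)
  have "runs Successors s ((168 * n + 23) * n)
    (\<lambda>s'. agree X s s' \<and> marked s' = marked s \<union> successors x y)"
    unfolding Successors_def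
  proof (rule runs_For[where I = I, OF n])
    show "I 0 (store s ''z'' 0 0)"
      by (auto simp: I_def X_def S_def store_apply intro!: agree_store agree_refl)
  next
    fix j s' assume j: "j < n" "I j s'"
    define P where "P s'' \<longleftrightarrow> agree X s s'' \<and> s'' ''z'' 0 = j \<and> marked s'' = marked s \<union> S j \<and>
      (s'' ''d'' 0 = 0 \<longleftrightarrow> common_nbrs E x j \<subseteq> nbrs E y)" for s''
    define P' where "P' s'' \<longleftrightarrow> P s'' \<and> s'' ''c'' 0 = card (common_nbrs E x j)" for s''
    have i': "inst s''" "s'' ''x'' 0 = x" "s'' ''y'' 0 = y" "s'' ''b'' 0 = card (cl x y)"
      if "agree X s s''" for s''
      using that s inst_agree[of X s s''] by (auto simp: X_def agree_def)
    have ag: "agree X s s'" and z: "s' ''z'' 0 = j" using j by (auto simp: I_def)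
    have iff: "card {v. v < n \<and> v \<in> nbrs E x \<and> v \<in> nbrs E j \<and> v \<notin> nbrs E y} = 0 \<longleftrightarrow>
        common_nbrs E x j \<subseteq> nbrs E y"
      using nbrs_less by (auto simp: common_nbrs_def)
    have "runs (Count ''d'' ''u'' (And (And (Adj ''x'' ''u'') (Adj ''z'' ''u'')) (Neg (Adj ''y'' ''u''))))
      s' ((bcost (And (And (Adj ''x'' ''u'') (Adj ''z'' ''u'')) (Neg (Adj ''y'' ''u''))) + 40) * n) P"
    proof (rule runs_Count[where \<phi> = "\<lambda>v. v \<in> nbrs E x \<and> v \<in> nbrs E j \<and> v \<notin> nbrs E y"])
      show "s' ''n'' 0 = n" using i'(1)[OF ag] inst_vars by blast
      show "P (store (store s' ''d'' 0
          (card {v. v < n \<and> v \<in> nbrs E x \<and> v \<in> nbrs E j \<and> v \<notin> nbrs E y})) ''u'' 0 n)"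
        using j(2) iff unfolding P_def I_def
        by (auto simp: store_apply X_def intro!: agree_store)
    qed (use i'[OF ag] z j s n in \<open>auto simp: bval_Adj store_apply\<close>)
    then have 1: "runs (Count ''d'' ''u'' (And (And (Adj ''x'' ''u'') (Adj ''z'' ''u'')) (Neg (Adj ''y'' ''u''))))
      s' (70 * n) P" by (simp add: Adj_def)
    have 2: "runs (Count ''c'' ''u'' (And (Adj ''x'' ''u'') (Adj ''z'' ''u''))) s'' (59 * n) P'"
      if P: "P s''" for s''
    proof -
      have ag: "agree X s s''" and z: "s'' ''z'' 0 = j" using P by (auto simp: P_def)
      have eq: "{v. v < n \<and> v \<in> nbrs E x \<and> v \<in> nbrs E j} = common_nbrs E x j"
        using nbrs_less by (auto simp: common_nbrs_def)
      have "runs (Count ''c'' ''u'' (And (Adj ''x'' ''u'') (Adj ''z'' ''u''))) s''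
          ((bcost (And (Adj ''x'' ''u'') (Adj ''z'' ''u'')) + 40) * n) P'"
      proof (rule runs_Count[where \<phi> = "\<lambda>v. v \<in> nbrs E x \<and> v \<in> nbrs E j"])
        show "s'' ''n'' 0 = n" using i'(1)[OF ag] inst_vars by blast
        show "P' (store (store s'' ''c'' 0 (card {v. v < n \<and> v \<in> nbrs E x \<and> v \<in> nbrs E j})) ''u'' 0 n)"
          unfolding eq using P unfolding P'_def P_def
          by (auto simp: store_apply X_def intro!: agree_store)
      qed (use i'[OF ag] z j s n in \<open>auto simp: bval_Adj store_apply\<close>)
      then show ?thesis by (simp add: Adj_def)
    qed
    have 3: "runs (Cond (And (And (Equal (Var ''d'') (Const 0)) (Less (Const 0) (Var ''c'')))
                 (Neg (Less (Plus (Var ''b'') (Var ''c'')) (Var ''k''))))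
           (Seq (Mark ''x'' ''z'') (Mark ''z'' ''x'')) Skip) s'' 37
        (\<lambda>s'. s' ''z'' 0 = j \<and> I (Suc j) (store s' ''z'' 0 (Suc j)))" (is "runs (Cond ?b _ _) _ _ ?Q")
      if P': "P' s''" for s''
    proof -
      have ag: "agree X s s''" and z: "s'' ''z'' 0 = j" and mk: "marked s'' = marked s \<union> S j"
        using P' by (auto simp: P'_def P_def)
      have pos: "0 < card (common_nbrs E x j) \<longleftrightarrow> common_nbrs E x j \<noteq> {}"
        using finite_common_nbrs[OF graph] by (auto simp: card_gt_0_iff)
      have b: "bval ?b s'' \<longleftrightarrow> step {0..<n} E k x y j"
        using P' i'(4)[OF ag] inst_vars[OF i'(1)[OF ag]] pos j(1)
        unfolding P'_def P_def step_def by (simp add: not_less conj_ac)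
      show ?thesis
      proof (rule runs_Cond[where T = 17])
        assume "bval ?b s''"
        then have st: "step {0..<n} E k x y j" using b by blast
        define t1 where "t1 = store s'' ''R'' (x * n + j) 1"
        define t2 where "t2 = store t1 ''R'' (j * n + x) 1"
        have t1: "inst t1" "t1 ''x'' 0 = x" "t1 ''z'' 0 = j"
          using i'[OF ag] z by (simp_all add: t1_def store_apply)
        have "agree X s t2"
          unfolding t2_def t1_def by (intro agree_store ag) (simp_all add: X_def)
        moreover have "marked t2 = marked s \<union> S (Suc j)"
          unfolding t2_def t1_def marked_insert[OF j(1) s(4)] marked_insert[OF s(4) j(1)]
          using mk st by (auto simp: S_Suc)
        moreover have "t2 ''z'' 0 = j" using t1 by (simp add: t2_def store_apply)
        ultimately have t2: "?Q t2" by (auto simp: I_def store_apply X_def intro!: agree_store)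
        have "runs (Mark ''x'' ''z'') s'' 8 (\<lambda>t. t = t1)"
          by (rule runs_Mark) (use i'[OF ag] z j(1) s(4) in \<open>simp_all add: t1_def\<close>)
        moreover have "runs (Mark ''z'' ''x'') t 8 ?Q" if "t = t1" for t
          unfolding that by (rule runs_Mark[OF t1(1)]) (use t1 j(1) s(4) t2 t2_def in simp_all)
        ultimately show "runs (Seq (Mark ''x'' ''z'') (Mark ''z'' ''x'')) s'' 17 ?Q"
          by (rule runs_le[OF runs_Seq]) simp_all
      next
        assume "\<not> bval ?b s''"
        then have st: "\<not> step {0..<n} E k x y j" using b by blast
        show "runs Skip s'' 17 ?Q"
          using z ag mk st by (intro runs_le[OF runs_Skip])
            (auto simp: I_def S_Suc store_apply X_def intro!: agree_store)
      qed simp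
    qed
    have "runs (Seq (Count ''d'' ''u'' (And (And (Adj ''x'' ''u'') (Adj ''z'' ''u'')) (Neg (Adj ''y'' ''u''))))
       (Seq (Count ''c'' ''u'' (And (Adj ''x'' ''u'') (Adj ''z'' ''u'')))
         (Cond (And (And (Equal (Var ''d'') (Const 0)) (Less (Const 0) (Var ''c'')))
                 (Neg (Less (Plus (Var ''b'') (Var ''c'')) (Var ''k''))))
           (Seq (Mark ''x'' ''z'') (Mark ''z'' ''x'')) Skip))) s' (70 * n + (59 * n + 37 + 1) + 1)
        (\<lambda>s'. s' ''z'' 0 = j \<and> I (Suc j) (store s' ''z'' 0 (Suc j)))"
      by (rule runs_Seq[OF 1 runs_Seq[OF 2 3]])
    then show "runs (Seq (Count ''d'' ''u'' (And (And (Adj ''x'' ''u'') (Adj ''z'' ''u'')) (Neg (Adj ''y'' ''u''))))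
       (Seq (Count ''c'' ''u'' (And (Adj ''x'' ''u'') (Adj ''z'' ''u'')))
         (Cond (And (And (Equal (Var ''d'') (Const 0)) (Less (Const 0) (Var ''c'')))
                 (Neg (Less (Plus (Var ''b'') (Var ''c'')) (Var ''k''))))
           (Seq (Mark ''x'' ''z'') (Mark ''z'' ''x'')) Skip))) s' (168 * n)
        (\<lambda>s'. s' ''z'' 0 = j \<and> I (Suc j) (store s' ''z'' 0 (Suc j)))"
      by (rule runs_le) (use n in simp)
  next
    fix j s' assume "I j s'"
    then show "s' ''z'' 0 = j \<and> s' ''n'' 0 = n"
      using s(1) agreeD[of X s s' "''n''"] by (auto simp: I_def X_def inst_vars)
  next
    fix s' assume "I n s'"
    \<comment> \<open>\<open>step\<close> includes that \<open>z\<close> is a vertex, so the loop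
      misses no successor.\<close>
    moreover have "S n = successors x y" by (auto simp: S_def successors_def step_def)
    ultimately show "agree X s s' \<and> marked s' = marked s \<union> successors x y" by (simp add: I_def)
  qed
  moreover have "(168 * n + 23) * n \<le> 191 * n ^ 2"
    using n by (simp add: power2_eq_square algebra_simps)
  ultimately show ?thesis unfolding X_def by (rule runs_le)
qed

lemma runs_Visit:
  assumes s: "inst s" "s ''x'' 0 = x" "s ''y'' 0 = y" "x < n" "y < n"
  shows "runs Visit s (330 * n ^ 2)
    (\<lambda>s'. agree {''b'', ''c'', ''d'', ''u'', ''z'', ''R'', ''ans''} s s' \<and>
      marked s' = (if (x, y) \<in> marked s then marked s \<union> successors x y else marked s) \<and>
      s' ''ans'' 0 = (if (x, y) \<in> marked s \<and> k \<le> card (cl x y) then 1 else s ''ans'' 0))"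
    (is "runs _ _ _ ?Q")
proof -
  have test: "bval (Equal (Cell ''R'' (Plus (Cell ''row'' (Var ''x'')) (Var ''y''))) (Const 1)) s
      \<longleftrightarrow> (x, y) \<in> marked s"
    using s by (simp add: marked_def inst_row)
  have n2: "1 \<le> n ^ 2" using n by simp
  show ?thesis
    unfolding Visit_def
  proof (rule runs_Cond[where T = "110 * n ^ 2 + (10 + 191 * n ^ 2 + 1) + 1"])
    assume "bval (Equal (Cell ''R'' (Plus (Cell ''row'' (Var ''x'')) (Var ''y''))) (Const 1)) s"
    then have mk: "(x, y) \<in> marked s" using test by simp
    show "runs (Seq Closure
       (Seq (Cond (Neg (Less (Var ''b'') (Var ''k''))) (Assign ''ans'' (Const 0) (Const 1)) Skip)
         Successors)) s (110 * n ^ 2 + (10 + 191 * n ^ 2 + 1) + 1) ?Q"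
    proof (rule runs_Seq[OF runs_Closure[OF s]])
      fix s1 assume a1: "agree {''b'', ''d'', ''u'', ''z''} s s1 \<and> s1 ''b'' 0 = card (cl x y)"
      have i1: "inst s1" using inst_agree[of _ s s1] a1 s(1) by fastforce
      have k1: "s1 ''k'' 0 = k" using inst_vars i1 by blast
      define P where "P s2 \<longleftrightarrow> agree {''b'', ''d'', ''u'', ''z'', ''ans''} s s2 \<and>
        s2 ''b'' 0 = card (cl x y) \<and>
        s2 ''ans'' 0 = (if k \<le> card (cl x y) then 1 else s ''ans'' 0)" for s2
      have c: "runs (Cond (Neg (Less (Var ''b'') (Var ''k''))) (Assign ''ans'' (Const 0) (Const 1)) Skip)
          s1 10 P"
        using a1 k1 by (intro runs_Cond[where T = 3] runs_Assign runs_le[OF runs_Skip])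
          (auto simp: P_def agree_def store_apply)
      show "runs (Seq (Cond (Neg (Less (Var ''b'') (Var ''k''))) (Assign ''ans'' (Const 0) (Const 1)) Skip)
         Successors) s1 (10 + 191 * n ^ 2 + 1) ?Q"
      proof (rule runs_Seq[OF c])
        fix s2 assume P: "P s2"
        then have ag: "agree {''b'', ''d'', ''u'', ''z'', ''ans''} s s2" by (simp add: P_def)
        have "inst s2" using inst_agree[OF ag s(1)] by simp
        moreover have "s2 ''x'' 0 = x" "s2 ''y'' 0 = y" "marked s2 = marked s"
          using ag s marked_agree[OF ag] by (auto simp: agree_def)
        moreover have "s2 ''b'' 0 = card (cl x y)" using P by (simp add: P_def)
        ultimately show "runs Successors s2 (191 * n ^ 2) ?Q"
        proof (intro runs_mono[OF runs_Successors[of s2 x y] order_refl])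
          fix s3 assume "agree {''c'', ''d'', ''u'', ''z'', ''R''} s2 s3 \<and>
            marked s3 = marked s2 \<union> successors x y"
          then show "?Q s3"
            using P ag mk \<open>marked s2 = marked s\<close> by (auto simp: P_def agree_def)
        qed (use s in auto)
      qed
    qed
  next
    assume "\<not> bval (Equal (Cell ''R'' (Plus (Cell ''row'' (Var ''x'')) (Var ''y''))) (Const 1)) s"
    then have "(x, y) \<notin> marked s" using test by simp
    then show "runs Skip s (110 * n ^ 2 + (10 + 191 * n ^ 2 + 1) + 1) ?Q"
      using n2 by (intro runs_le[OF runs_Skip]) (auto simp: agree_refl)
  qed (use n2 in simp)
qed

text \<open>Marking happens in place, so within one round a state of a later level may already be
  visited; only the states of level \<open>r\<close> are guaranteed to be treated in round \<open>r\<close>.\<close>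

definition round_inv :: "nat \<Rightarrow> (nat \<times> nat) set \<Rightarrow> (nat \<times> nat) set \<Rightarrow> nat \<Rightarrow> bool" where
  "round_inv r D S a \<longleftrightarrow>
     level {0..<n} E k r \<subseteq> S \<and> S \<subseteq> (\<Union>i. level {0..<n} E k i) \<and>
     (\<forall>x y. (x, y) \<in> D \<longrightarrow> (x, y) \<in> level {0..<n} E k r \<longrightarrow>
       successors x y \<subseteq> S \<and> (k \<le> card (cl x y) \<longrightarrow> a = 1)) \<and>
     (\<forall>i x y. i < r \<longrightarrow> (x, y) \<in> level {0..<n} E k i \<longrightarrow> k \<le> card (cl x y) \<longrightarrow> a = 1) \<and>
     (a = 0 \<or> a = 1 \<and> (\<exists>i x y. (x, y) \<in> level {0..<n} E k i \<and> k \<le> card (cl x y)))"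

text \<open>A pair outside \<open>S\<close> is not in level \<open>r\<close>, so skipping it is
  harmless. A pair in \<open>S\<close> belongs to some level \<open>i\<close>, perhaps not
  \<open>r\<close>; its successors then belong to level \<open>i + 1\<close>, which keeps
  \<open>S\<close> inside the union of all levels.\<close>

lemma round_inv_visit:
  assumes "round_inv r D S a"
  shows "round_inv r (insert (x, y) D) (if (x, y) \<in> S then S \<union> successors x y else S)
    (if (x, y) \<in> S \<and> k \<le> card (cl x y) then 1 else a)"
proof -
  define S' where "S' = (if (x, y) \<in> S then S \<union> successors x y else S)"
  define a' where "a' = (if (x, y) \<in> S \<and> k \<le> card (cl x y) then 1 else a)"
  have lev: "level {0..<n} E k r \<subseteq> S" and sub: "S \<subseteq> (\<Union>i. level {0..<n} E k i)"
    and D: "\<forall>x y. (x, y) \<in> D \<longrightarrow> (x, y) \<in> level {0..<n} E k r \<longrightarrow>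
       successors x y \<subseteq> S \<and> (k \<le> card (cl x y) \<longrightarrow> a = 1)"
    and old: "\<forall>i x y. i < r \<longrightarrow> (x, y) \<in> level {0..<n} E k i \<longrightarrow> k \<le> card (cl x y) \<longrightarrow> a = 1"
    and ans: "a = 0 \<or> a = 1 \<and> (\<exists>i x y. (x, y) \<in> level {0..<n} E k i \<and> k \<le> card (cl x y))"
    using assms unfolding round_inv_def by - (elim conjE, assumption)+
  have S': "S \<subseteq> S'" "(x, y) \<in> S \<Longrightarrow> successors x y \<subseteq> S'" by (auto simp: S'_def)
  have a': "a = 1 \<Longrightarrow> a' = 1" "(x, y) \<in> S \<Longrightarrow> k \<le> card (cl x y) \<Longrightarrow> a' = 1" by (auto simp: a'_def)
  have union: "S' \<subseteq> (\<Union>i. level {0..<n} E k i)"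
  proof (cases "(x, y) \<in> S")
    case True
    then obtain i where "(x, y) \<in> level {0..<n} E k i" using sub by blast
    then have "successors x y \<subseteq> level {0..<n} E k (Suc i)"
      unfolding successors_def by auto
    also have "\<dots> \<subseteq> (\<Union>i. level {0..<n} E k i)" by (rule UN_upper) simp
    finally show ?thesis using sub True by (simp only: S'_def if_True Un_least)
  qed (use sub in \<open>simp add: S'_def\<close>)
  have visited: "successors v w \<subseteq> S' \<and> (k \<le> card (cl v w) \<longrightarrow> a' = 1)"
    if vw: "(v, w) \<in> insert (x, y) D" "(v, w) \<in> level {0..<n} E k r" for v w
  proof (cases "(v, w) = (x, y)")
    case True
    then show ?thesis using vw lev S'(2) a'(2) by auto
  next
    case False
    then have "(v, w) \<in> D" using vw(1) by blast
    then have "successors v w \<subseteq> S \<and> (k \<le> card (cl v w) \<longrightarrow> a = 1)"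
      using vw(2) by (rule D[rule_format])
    then show ?thesis using S'(1) a'(1) by auto
  qed
  have answer: "a' = 0 \<or> a' = 1 \<and> (\<exists>i x y. (x, y) \<in> level {0..<n} E k i \<and> k \<le> card (cl x y))"
  proof (cases "(x, y) \<in> S \<and> k \<le> card (cl x y)")
    case True
    then obtain i where "(x, y) \<in> level {0..<n} E k i" using sub by blast
    moreover have "a' = 1" using True unfolding a'_def by (rule if_P)
    ultimately show ?thesis using True by blast
  next
    case False
    then have "a' = a" unfolding a'_def by (rule if_not_P)
    with ans show ?thesis by simp
  qed
  have older: "a' = 1" if "i < r" "(v, w) \<in> level {0..<n} E k i" "k \<le> card (cl v w)" for i v w
    using old[rule_format, OF that] a'(1) by simp
  show ?thesis
    unfolding round_inv_def S'_def[symmetric] a'_def[symmetric]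
    using order_trans[OF lev S'(1)] union visited older answer by (intro conjI allI impI; simp only:)
qed

text \<open>When all pairs have been visited, every pair of level \<open>r\<close> has contributed
  its successors, and these make up level \<open>r + 1\<close>.\<close>

lemma round_inv_next:
  assumes "round_inv r ({0..<n} \<times> {0..<n}) S a" "S \<subseteq> {0..<n} \<times> {0..<n}"
  shows "round_inv (Suc r) {} S a"
proof -
  have lev: "level {0..<n} E k r \<subseteq> S" and sub: "S \<subseteq> (\<Union>i. level {0..<n} E k i)"
    and D: "\<forall>x y. (x, y) \<in> {0..<n} \<times> {0..<n} \<longrightarrow> (x, y) \<in> level {0..<n} E k r \<longrightarrow>
       successors x y \<subseteq> S \<and> (k \<le> card (cl x y) \<longrightarrow> a = 1)"
    and old: "\<forall>i x y. i < r \<longrightarrow> (x, y) \<in> level {0..<n} E k i \<longrightarrow> k \<le> card (cl x y) \<longrightarrow> a = 1"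
    and ans: "a = 0 \<or> a = 1 \<and> (\<exists>i x y. (x, y) \<in> level {0..<n} E k i \<and> k \<le> card (cl x y))"
    using assms(1) unfolding round_inv_def by - (elim conjE, assumption)+
  have treated: "successors x y \<subseteq> S \<and> (k \<le> card (cl x y) \<longrightarrow> a = 1)"
    if "(x, y) \<in> level {0..<n} E k r" for x y
    using D[rule_format, OF subsetD[OF assms(2) subsetD[OF lev that]] that] .
  have "level {0..<n} E k (Suc r) \<subseteq> S"
  proof
    fix q assume "q \<in> level {0..<n} E k (Suc r)"
    then obtain x y where "(x, y) \<in> level {0..<n} E k r" "q \<in> successors x y"
      unfolding level.simps successors_def by blast
    then show "q \<in> S" using treated[of x y] by (meson subsetD)
  qed
  moreover have "a = 1" if "i < Suc r" "(x, y) \<in> level {0..<n} E k i" "k \<le> card (cl x y)" for i x y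
    using that treated[of x y] old[rule_format, of i x y] unfolding less_Suc_eq by auto
  ultimately show ?thesis
    using sub ans unfolding round_inv_def by (intro conjI) auto
qed

lemma marked_subset: "marked s \<subseteq> {0..<n} \<times> {0..<n}"
  by (auto simp: marked_def)

lemma runs_Rounds:
  assumes s: "inst s" "marked s = level {0..<n} E k 0" "s ''ans'' 0 = 0"
  shows "runs Rounds s (399 * (m * n ^ 4)) (\<lambda>s'. \<exists>S. round_inv m {} S (s' ''ans'' 0))"
proof -
  define J where "J r D s' \<longleftrightarrow> inst s' \<and> s' ''r'' 0 = r \<and> round_inv r D (marked s') (s' ''ans'' 0)"
    for r D s'
  have J_store: "J r D (store s' v i w) = J r D s'" if "v \<in> {''x'', ''y''}" for r D s' v i w
    using that by (auto simp: J_def store_apply)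
  have vn: "s' ''n'' 0 = n" if "J r D s'" for r D s' using that inst_vars by (auto simp: J_def)
  have Y: "runs (For ''y'' ''n'' Visit) s0 ((330 * n ^ 2 + 23) * n)
      (\<lambda>s'. s' ''x'' 0 = x \<and> J r ({0..<Suc x} \<times> {0..<n}) s')"
    if "x < n" "s0 ''x'' 0 = x" "J r ({0..<x} \<times> {0..<n}) s0" for r x s0
  \<comment> \<open>Pairs are visited row by row: the rows before \<open>x\<close> are complete, and
    row \<open>x\<close> is done up to column \<open>j\<close>.\<close>
  proof (rule runs_For[OF n, where I = "\<lambda>j s'. s' ''y'' 0 = j \<and> s' ''x'' 0 = x \<and>
      J r ({0..<x} \<times> {0..<n} \<union> {x} \<times> {0..<j}) s'"])
    fix j s1 assume j: "j < n" and I: "s1 ''y'' 0 = j \<and> s1 ''x'' 0 = x \<and>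
      J r ({0..<x} \<times> {0..<n} \<union> {x} \<times> {0..<j}) s1"
    have D: "{0..<x} \<times> {0..<n} \<union> {x} \<times> {0..<Suc j} =
        insert (x, j) ({0..<x} \<times> {0..<n} \<union> {x} \<times> {0..<j})" by auto
    have "inst s1" using I by (simp add: J_def)
    show "runs Visit s1 (330 * n ^ 2) (\<lambda>s'. s' ''y'' 0 = j \<and>
        store s' ''y'' 0 (Suc j) ''y'' 0 = Suc j \<and> store s' ''y'' 0 (Suc j) ''x'' 0 = x \<and>
        J r ({0..<x} \<times> {0..<n} \<union> {x} \<times> {0..<Suc j}) (store s' ''y'' 0 (Suc j)))"
    proof (rule runs_mono[OF runs_Visit[of s1 x j] order_refl])
      fix s2 assume s2: "agree {''b'', ''c'', ''d'', ''u'', ''z'', ''R'', ''ans''} s1 s2 \<and>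
        marked s2 = (if (x, j) \<in> marked s1 then marked s1 \<union> successors x j else marked s1) \<and>
        s2 ''ans'' 0 = (if (x, j) \<in> marked s1 \<and> k \<le> card (cl x j) then 1 else s1 ''ans'' 0)"
      have "s2 ''x'' = s1 ''x''" "s2 ''y'' = s1 ''y''" "s2 ''r'' = s1 ''r''"
        using s2 by (auto simp: agree_def)
      moreover have "inst s2" by (rule inst_agree[OF conjunct1[OF s2] \<open>inst s1\<close>]) simp
      moreover have "round_inv r (insert (x, j) ({0..<x} \<times> {0..<n} \<union> {x} \<times> {0..<j}))
          (marked s2) (s2 ''ans'' 0)"
      proof -
        have "marked s2 = (if (x, j) \<in> marked s1 then marked s1 \<union> successors x j else marked s1)"
          "s2 ''ans'' 0 = (if (x, j) \<in> marked s1 \<and> k \<le> card (cl x j) then 1 else s1 ''ans'' 0)"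
          using s2 by blast+
        moreover have "round_inv r ({0..<x} \<times> {0..<n} \<union> {x} \<times> {0..<j}) (marked s1) (s1 ''ans'' 0)"
          using I by (simp only: J_def)
        ultimately show ?thesis using round_inv_visit by (simp only:)
      qed
      ultimately show "s2 ''y'' 0 = j \<and>
        store s2 ''y'' 0 (Suc j) ''y'' 0 = Suc j \<and> store s2 ''y'' 0 (Suc j) ''x'' 0 = x \<and>
        J r ({0..<x} \<times> {0..<n} \<union> {x} \<times> {0..<Suc j}) (store s2 ''y'' 0 (Suc j))"
        using I unfolding D J_def by (simp add: store_apply)
    qed (use I j that(1) \<open>inst s1\<close> in simp_all)
  next
    have "{0..<x} \<times> {0..<n} \<union> {x} \<times> {0..<n} = {0..<Suc x} \<times> {0..<n}" by auto
    then show "s' ''x'' 0 = x \<and> J r ({0..<Suc x} \<times> {0..<n}) s'"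
      if "s' ''y'' 0 = n \<and> s' ''x'' 0 = x \<and> J r ({0..<x} \<times> {0..<n} \<union> {x} \<times> {0..<n}) s'" for s'
      using that by simp
  next
    fix j s1
    assume "s1 ''y'' 0 = j \<and> s1 ''x'' 0 = x \<and> J r ({0..<x} \<times> {0..<n} \<union> {x} \<times> {0..<j}) s1"
    then show "s1 ''y'' 0 = j \<and> s1 ''n'' 0 = n" using vn by blast
  qed (use that in \<open>auto simp: J_store store_apply\<close>)
  have X: "runs (For ''x'' ''n'' (For ''y'' ''n'' Visit)) s0 (((330 * n ^ 2 + 23) * n + 23) * n)
      (J r ({0..<n} \<times> {0..<n}))" if "J r {} s0" for r s0
  proof (rule runs_For[OF n, where I = "\<lambda>j s'. s' ''x'' 0 = j \<and> J r ({0..<j} \<times> {0..<n}) s'"])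
    fix j s1 assume "j < n" "s1 ''x'' 0 = j \<and> J r ({0..<j} \<times> {0..<n}) s1"
    then show "runs (For ''y'' ''n'' Visit) s1 ((330 * n ^ 2 + 23) * n) (\<lambda>s'. s' ''x'' 0 = j \<and>
        store s' ''x'' 0 (Suc j) ''x'' 0 = Suc j \<and> J r ({0..<Suc j} \<times> {0..<n}) (store s' ''x'' 0 (Suc j)))"
      by (intro runs_mono[OF Y order_refl]) (auto simp: J_store store_apply)
  next
    fix j s1 assume "s1 ''x'' 0 = j \<and> J r ({0..<j} \<times> {0..<n}) s1"
    then show "s1 ''x'' 0 = j \<and> s1 ''n'' 0 = n" using vn by blast
  qed (use that in \<open>auto simp: J_store store_apply\<close>)
  have "runs Rounds s (((((330 * n ^ 2 + 23) * n + 23) * n) + 23) * m)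
      (\<lambda>s'. \<exists>S. round_inv m {} S (s' ''ans'' 0))"
    unfolding Rounds_def
  proof (rule runs_For[OF m, where I = "\<lambda>r. J r {}"])
    show "J 0 {} (store s ''r'' 0 0)"
    proof -
      have "level {0..<n} E k 0 \<subseteq> (\<Union>i. level {0..<n} E k i)" by (rule UN_upper) simp
      then have "round_inv 0 {} (level {0..<n} E k 0) 0" by (simp add: round_inv_def del: level.simps)
      then show ?thesis using s by (simp add: J_def store_apply del: level.simps)
    qed
  next
    fix r s1 assume "J r {} s1"
    then show "runs (For ''x'' ''n'' (For ''y'' ''n'' Visit)) s1 (((330 * n ^ 2 + 23) * n + 23) * n)
      (\<lambda>s'. s' ''r'' 0 = r \<and> J (Suc r) {} (store s' ''r'' 0 (Suc r)))"
      by (intro runs_mono[OF X order_refl])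
        (auto simp: J_def store_apply intro: round_inv_next[OF _ marked_subset])
  qed (auto simp: J_def inst_vars)
  moreover have "((((330 * n ^ 2 + 23) * n + 23) * n) + 23) * m \<le> 399 * (m * n ^ 4)"
  proof -
    have "n ^ 2 * n * n = n ^ 4" "n * n = n ^ 2" by (simp_all add: power2_eq_square power4_eq_xxxx)
    moreover have "n ^ 2 \<le> n ^ 4" "n \<le> n ^ 4" "1 \<le> n ^ 4"
      using n by (simp_all add: power_increasing self_le_power)
    \<comment> \<open>The constant is \<open>330\<close> for a visit plus \<open>23\<close> for each
      of the three nested loops.\<close>
    ultimately have "(((330 * n ^ 2 + 23) * n + 23) * n) + 23 \<le> 399 * n ^ 4"
      by (simp add: algebra_simps)
    from mult_le_mono2[OF this, of m] show ?thesis by (simp only: mult.commute mult.left_commute)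
  qed
  ultimately show ?thesis by (rule runs_le)
qed

lemma runs_Start:
  assumes s: "inst s" "marked s = {}" "s ''ans'' 0 = 0"
  shows "runs Start s (88 * n ^ 2)
    (\<lambda>s'. inst s' \<and> marked s' = level {0..<n} E k 0 \<and> s' ''ans'' 0 = 0)"
proof -
  define S where "S j = {(x, x) |x. x < j \<and> k \<le> card (nbrs E x)}" for j :: nat
  have S_Suc: "S (Suc j) = (if k \<le> card (nbrs E j) then insert (j, j) (S j) else S j)" for j
    by (auto simp: S_def less_Suc_eq)
  define I where "I j s' \<longleftrightarrow> inst s' \<and> s' ''x'' 0 = j \<and> marked s' = S j \<and> s' ''ans'' 0 = 0" for j s'
  have "runs Start s ((49 * n + 16 + 23) * n)
    (\<lambda>s'. inst s' \<and> marked s' = level {0..<n} E k 0 \<and> s' ''ans'' 0 = 0)"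
    unfolding Start_def
  proof (rule runs_For[OF n, where I = I])
    fix j s' assume j: "j < n" and I: "I j s'"
    define P where "P s'' \<longleftrightarrow> I j s'' \<and> s'' ''c'' 0 = card (nbrs E j)" for s''
    have eq: "{v. v < n \<and> v \<in> nbrs E j} = nbrs E j" using nbrs_less by auto
    have "runs (Count ''c'' ''u'' (Adj ''x'' ''u'')) s' ((bcost (Adj ''x'' ''u'') + 40) * n) P"
    proof (rule runs_Count[where \<phi> = "\<lambda>v. v \<in> nbrs E j"])
      show "P (store (store s' ''c'' 0 (card {v. v < n \<and> v \<in> nbrs E j})) ''u'' 0 n)"
        unfolding eq using I by (auto simp: P_def I_def store_apply)
      show "s' ''n'' 0 = n" using I inst_vars by (auto simp: I_def)
    qed (use I n j in \<open>auto simp: I_def bval_Adj store_apply\<close>)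
    then have 1: "runs (Count ''c'' ''u'' (Adj ''x'' ''u'')) s' (49 * n) P" by (simp add: Adj_def)
    have 2: "runs (Cond (Neg (Less (Var ''c'') (Var ''k''))) (Mark ''x'' ''x'') Skip) s'' 15
        (\<lambda>s'. s' ''x'' 0 = j \<and> I (Suc j) (store s' ''x'' 0 (Suc j)))" if "P s''" for s''
    proof -
      have i: "inst s''" "s'' ''x'' 0 = j" "marked s'' = S j" "s'' ''ans'' 0 = 0"
        and c: "s'' ''c'' 0 = card (nbrs E j)"
        using that by (auto simp: P_def I_def)
      have k: "s'' ''k'' 0 = k" using inst_vars[OF i(1)] by blast
      have mark: "marked (store s'' ''R'' (j * n + j) 1) = insert (j, j) (S j)"
        using marked_insert[OF j j] i(3) by simp
      show ?thesis
        using i c k j mark by (intro runs_Cond[where T = 8] runs_Mark runs_le[OF runs_Skip])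
          (simp_all add: I_def store_apply S_Suc)
    qed
    show "runs (Seq (Count ''c'' ''u'' (Adj ''x'' ''u''))
         (Cond (Neg (Less (Var ''c'') (Var ''k''))) (Mark ''x'' ''x'') Skip)) s' (49 * n + 16)
        (\<lambda>s'. s' ''x'' 0 = j \<and> I (Suc j) (store s' ''x'' 0 (Suc j)))"
      by (rule runs_le[OF runs_Seq[OF 1 2]]) simp_all
  next
    show "I 0 (store s ''x'' 0 0)" using s by (auto simp: I_def S_def store_apply)
  next
    fix j s' assume "I j s'"
    then show "s' ''x'' 0 = j \<and> s' ''n'' 0 = n" using inst_vars unfolding I_def by blast
  qed (simp add: I_def S_def)
  moreover have "(49 * n + 16 + 23) * n \<le> 88 * n ^ 2"
    using n by (simp add: power2_eq_square algebra_simps)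
  ultimately show ?thesis by (rule runs_le)
qed

end

section \<open>Initialisation: row offsets and adjacency matrix\<close>

lemma runs_Rows:
  assumes "1 \<le> n" "s ''n'' 0 = n" "s ''row'' 0 = 0"
  shows "runs Rows s (34 * n) (\<lambda>s'. agree {''u'', ''row''} s s' \<and> (\<forall>i\<le>n. s' ''row'' i = i * n))"
proof -
  have "runs Rows s ((11 + 23) * n)
      (\<lambda>s'. agree {''u'', ''row''} s s' \<and> (\<forall>i\<le>n. s' ''row'' i = i * n))"
    unfolding Rows_def
  proof (rule runs_For[OF assms(1), where I = "\<lambda>j s'. agree {''u'', ''row''} s s' \<and> s' ''u'' 0 = j \<and>
      (\<forall>i\<le>j. s' ''row'' i = i * n)"])
    show "agree {''u'', ''row''} s (store s ''u'' 0 0) \<and> store s ''u'' 0 0 ''u'' 0 = 0 \<and>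
        (\<forall>i\<le>0. store s ''u'' 0 0 ''row'' i = i * n)"
      using assms(3) by (simp add: agree_store agree_refl store_apply)
  next
    fix j s'
    assume I: "agree {''u'', ''row''} s s' \<and> s' ''u'' 0 = j \<and> (\<forall>i\<le>j. s' ''row'' i = i * n)"
    then have "s' ''n'' = s ''n''" by (simp add: agree_def)
    then have n: "s' ''n'' 0 = n" using assms(2) by simp
    then show "s' ''u'' 0 = j \<and> s' ''n'' 0 = n" using I by blast
    \<comment> \<open>Iteration \<open>j\<close> fills cell \<open>j + 1\<close>; cell
      \<open>0\<close> is correct from the beginning.\<close>
    define t where "t = store s' ''row'' (Suc j) (j * n + n)"
    have "\<forall>i\<le>Suc j. t ''row'' i = i * n" using I by (simp add: t_def store_apply le_Suc_eq)
    moreover have "agree {''u'', ''row''} s t" unfolding t_def by (rule agree_store) (use I in simp_all)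
    moreover have "t ''u'' 0 = j" using I by (simp add: t_def store_apply)
    ultimately show "runs (Assign ''row'' (Plus (Var ''u'') (Const 1)) (Plus (Cell ''row'' (Var ''u'')) (Var ''n''))) s' 11
        (\<lambda>s'. s' ''u'' 0 = j \<and> agree {''u'', ''row''} s (store s' ''u'' 0 (Suc j)) \<and>
          store s' ''u'' 0 (Suc j) ''u'' 0 = Suc j \<and> (\<forall>i\<le>Suc j. store s' ''u'' 0 (Suc j) ''row'' i = i * n))"
      using I n by (intro runs_Assign) (simp_all add: t_def agree_store store_apply)
  qed blast
  then show ?thesis by simp
qed

lemma runs_Edges:
  assumes "1 \<le> m" "s ''m'' 0 = m" "\<forall>i\<le>n. s ''row'' i = i * n" "s ''adj'' = (\<lambda>_. 0)"
    and uv: "\<And>i. i < m \<Longrightarrow> s ''src'' i < n \<and> s ''dst'' i < n"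
  shows "runs Edges s (44 * m) (\<lambda>s'. agree {''r'', ''adj''} s s' \<and>
    (\<forall>x<n. \<forall>y<n. s' ''adj'' (x * n + y) = 1 \<longleftrightarrow> (\<exists>i<m. {x, y} = {s ''src'' i, s ''dst'' i})))"
proof -
  define I where "I j s' \<longleftrightarrow> agree {''r'', ''adj''} s s' \<and> s' ''r'' 0 = j \<and>
    (\<forall>x<n. \<forall>y<n. s' ''adj'' (x * n + y) = 1 \<longleftrightarrow> (\<exists>i<j. {x, y} = {s ''src'' i, s ''dst'' i}))" for j s'
  have "runs Edges s ((21 + 23) * m) (I m)"
    unfolding Edges_def
  proof (rule runs_For[OF assms(1), where I = I])
    fix j s' assume j: "j < m" and I: "I j s'"
    define u where "u = s ''src'' j"
    define v where "v = s ''dst'' j"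
    have lt: "u < n" "v < n" using uv[OF j] by (auto simp: u_def v_def)
    have eqs: "s' ''src'' = s ''src''" "s' ''dst'' = s ''dst''" "s' ''row'' = s ''row''" "s' ''r'' 0 = j"
      using I by (auto simp: I_def agree_def)
    have row: "s ''row'' u = u * n" "s ''row'' v = v * n" using assms(3) lt by auto
    define s2 where "s2 = store (store s' ''adj'' (u * n + v) 1) ''adj'' (v * n + u) 1"
    have "s2 ''adj'' (x * n + y) = 1 \<longleftrightarrow> (\<exists>i<Suc j. {x, y} = {s ''src'' i, s ''dst'' i})"
      if "x < n" "y < n" for x y
    proof -
      \<comment> \<open>Both orientations are entered, and distinct pairs of vertices have distinct
        indices.\<close>
      have "s2 ''adj'' (x * n + y) = 1 \<longleftrightarrow> {x, y} = {u, v} \<or> s' ''adj'' (x * n + y) = 1"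
        using index_eq_iff[OF that(2) lt(2)] index_eq_iff[OF that(2) lt(1)]
        by (auto simp: s2_def store_apply doubleton_eq_iff)
      moreover have "s' ''adj'' (x * n + y) = 1 \<longleftrightarrow> (\<exists>i<j. {x, y} = {s ''src'' i, s ''dst'' i})"
        using I that by (simp add: I_def)
      ultimately show ?thesis unfolding less_Suc_eq u_def v_def by metis
    qed
    moreover have "agree {''r'', ''adj''} s s2"
      unfolding s2_def by (intro agree_store) (use I in \<open>simp_all add: I_def\<close>)
    moreover have "s2 ''r'' 0 = j" using eqs(4) by (simp add: s2_def store_apply)
    ultimately have fin: "s2 ''r'' 0 = j \<and> I (Suc j) (store s2 ''r'' 0 (Suc j))"
      unfolding I_def by (simp add: agree_store store_apply)
    have idx: "s' ''row'' (s' ''src'' (s' ''r'' 0)) + s' ''dst'' (s' ''r'' 0) = u * n + v"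
      "s' ''row'' (s' ''dst'' (s' ''r'' 0)) + s' ''src'' (s' ''r'' 0) = v * n + u"
      using row unfolding eqs u_def v_def by simp_all
    have "runs (Set_adj ''src'' ''dst'') s' 10 (\<lambda>t. t = store s' ''adj'' (u * n + v) 1)"
      unfolding Set_adj_def by (rule runs_Assign) (simp_all add: idx)
    moreover have "runs (Set_adj ''dst'' ''src'') t 10 (\<lambda>t. t = s2)"
      if "t = store s' ''adj'' (u * n + v) 1" for t
      unfolding that Set_adj_def by (rule runs_Assign) (simp_all add: store_apply idx s2_def)
    ultimately have "runs (Seq (Set_adj ''src'' ''dst'') (Set_adj ''dst'' ''src'')) s' (10 + 10 + 1) (\<lambda>t. t = s2)"
      by (rule runs_Seq)
    then show "runs (Seq (Set_adj ''src'' ''dst'') (Set_adj ''dst'' ''src'')) s' 21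
        (\<lambda>s'. s' ''r'' 0 = j \<and> I (Suc j) (store s' ''r'' 0 (Suc j)))"
      by (rule runs_mono) (use fin in auto)
  next
    fix j s' assume "I j s'"
    then have "s' ''r'' 0 = j" "s' ''m'' = s ''m''" by (simp_all add: I_def agree_def)
    then show "s' ''r'' 0 = j \<and> s' ''m'' 0 = m" using assms(2) by simp
  qed (use assms(4) in \<open>simp_all add: I_def agree_store agree_refl store_apply\<close>)
  then show ?thesis by (rule runs_mono) (simp_all add: I_def)
qed

section \<open>From the edge listing to the correctness of the whole program\<close>

lemma edge_listing_conv:
  assumes "edge_listing E es"
  shows "length es = card E" "{x, y} \<in> E \<longleftrightarrow> (\<exists>i<length es. {x, y} = {fst (es ! i), snd (es ! i)})"
proof -
  have d: "distinct (map (\<lambda>(u, v). {u, v}) es)" and set: "set (map (\<lambda>(u, v). {u, v}) es) = E"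
    using assms by (simp_all add: edge_listing_def)
  from distinct_card[OF d] set show "length es = card E" by simp
  show "{x, y} \<in> E \<longleftrightarrow> (\<exists>i<length es. {x, y} = {fst (es ! i), snd (es ! i)})"
  proof -
    have "map (\<lambda>(u, v). {u, v}) es ! i = {fst (es ! i), snd (es ! i)}" if "i < length es" for i
      using that by (simp add: case_prod_unfold)
    then show ?thesis unfolding set[symmetric] in_set_conv_nth length_map by metis
  qed
qed

lemma clique_matching_program_decides:
  assumes G: "bipartite_permutation_graph {0..<n} E" and es: "edge_listing E es" and k: "k \<ge> 1"
  shows "decides_within clique_matching_program (input_state n es k) (has_clique_matching E k)
    (600 * (card E * n ^ 4 + 1))"
proof -
  define s where "s = input_state n es k"
  define m where "m = card E"
  have g: "simple_graph {0..<n} E" and bip: "bipartite {0..<n} E"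
    using G by (auto simp: bipartite_permutation_graph_def)
  note len = edge_listing_conv(1)[OF es] and edge = edge_listing_conv(2)[OF es]
  have finE: "finite E"
    using g finite_subset[of E "Pow {0..<n}"] by (auto simp: simple_graph_def)
  have vars: "s ''n'' 0 = n" "s ''m'' 0 = m" "s ''k'' 0 = k" "s ''row'' 0 = 0" "s ''ans'' 0 = 0"
    "s ''adj'' = (\<lambda>_. 0)" "s ''R'' = (\<lambda>_. 0)"
    "\<And>i. i < m \<Longrightarrow> s ''src'' i = fst (es ! i)" "\<And>i. i < m \<Longrightarrow> s ''dst'' i = snd (es ! i)"
    by (auto simp: s_def m_def input_state_def len)
  have "runs clique_matching_program s (600 * (m * n ^ 4 + 1))
      (\<lambda>s'. s' ''ans'' 0 = (if has_clique_matching E k then 1 else 0))"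
  proof (cases "m = 0")
    case True
    then have "E = {}" using finE by (simp add: m_def)
    then have "\<not> has_clique_matching E k"
      using k by (auto simp: has_clique_matching_def clique_matching_def matching_def)
    then show ?thesis
      unfolding clique_matching_program_def
      by (intro runs_Cond[where T = 1] runs_Skip) (use True vars in auto)
  next
    case False
    have uv: "fst (es ! i) < n \<and> snd (es ! i) < n" if "i < m" for i
    proof -
      have "{fst (es ! i), snd (es ! i)} \<in> E" unfolding edge using that len m_def by auto
      then show ?thesis using g by (auto simp: simple_graph_def)
    qed
    have "1 \<le> n" using uv[of 0] False by simp
    then interpret ram_instance n m k E using g False by unfold_locales auto
    have "runs (Seq Rows (Seq Edges (Seq Start Rounds))) s
      (34 * n + (44 * m + (88 * n ^ 2 + 399 * (m * n ^ 4) + 1) + 1) + 1)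
      (\<lambda>s'. \<exists>S. round_inv m {} S (s' ''ans'' 0))"
    proof (rule runs_Seq[OF runs_Rows[OF n]])
      fix s1 assume s1: "agree {''u'', ''row''} s s1 \<and> (\<forall>i\<le>n. s1 ''row'' i = i * n)"
      then have e1: "s1 v = s v" if "v \<notin> {''u'', ''row''}" for v using that by (simp add: agree_def)
      show "runs (Seq Edges (Seq Start Rounds)) s1
          (44 * m + (88 * n ^ 2 + 399 * (m * n ^ 4) + 1) + 1) (\<lambda>s'. \<exists>S. round_inv m {} S (s' ''ans'' 0))"
      proof (rule runs_Seq[OF runs_Edges[OF m, of _ n]])
        fix s2 assume s2: "agree {''r'', ''adj''} s1 s2 \<and> (\<forall>x<n. \<forall>y<n. s2 ''adj'' (x * n + y) = 1 \<longleftrightarrow>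
          (\<exists>i<m. {x, y} = {s1 ''src'' i, s1 ''dst'' i}))"
        then have e2: "s2 v = s1 v" if "v \<notin> {''r'', ''adj''}" for v using that by (simp add: agree_def)
        have "(\<exists>i<m. {x, y} = {s1 ''src'' i, s1 ''dst'' i}) \<longleftrightarrow> {x, y} \<in> E" for x y
        proof -
          have "s1 ''src'' i = fst (es ! i)" "s1 ''dst'' i = snd (es ! i)" if "i < m" for i
            using vars(8,9)[OF that] e1 by simp_all
          then show ?thesis unfolding edge len m_def by (metis (no_types, lifting))
        qed
        then have "inst s2" using s1 s2 e1 e2 vars by (simp add: inst_def)
        moreover have "marked s2 = {}" "s2 ''ans'' 0 = 0" using e1 e2 vars by (auto simp: marked_def)
        ultimately show "runs (Seq Start Rounds) s2 (88 * n ^ 2 + 399 * (m * n ^ 4) + 1)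
            (\<lambda>s'. \<exists>S. round_inv m {} S (s' ''ans'' 0))"
          by (intro runs_Seq[OF runs_Start]) (auto intro: runs_Rounds)
      qed (use s1 e1 vars uv in auto)
    qed (use vars in auto)
    then have "runs clique_matching_program s
      (5 + (34 * n + (44 * m + (88 * n ^ 2 + 399 * (m * n ^ 4) + 1) + 1) + 1))
      (\<lambda>s'. \<exists>S. round_inv m {} S (s' ''ans'' 0))"
      unfolding clique_matching_program_def using False vars by (intro runs_Cond) auto
    then show ?thesis
    proof (rule runs_mono)
      have le: "n \<le> n ^ 4" "n ^ 2 \<le> n ^ 4" "1 \<le> n ^ 4"
        using n by (simp_all add: power_increasing self_le_power)
      have mn: "n ^ 4 \<le> m * n ^ 4" "m \<le> m * n ^ 4"
        using m le(3) by simp_all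
      \<comment> \<open>With \<open>q\<close> for \<open>n ^ 2\<close> and \<open>w\<close> for
        \<open>m * n ^ 4\<close> the bound is linear: the coefficients add up to \<open>565\<close>,
        the constants to \<open>8\<close>.\<close>
      have "5 + (34 * n + (44 * m + (88 * q + 399 * w + 1) + 1) + 1) \<le> 600 * (w + 1)"
        if "n \<le> w" "q \<le> w" "m \<le> w" for q w
        using that by simp
      from this[OF order_trans[OF le(1) mn(1)] order_trans[OF le(2) mn(1)] mn(2)]
      show "5 + (34 * n + (44 * m + (88 * n ^ 2 + 399 * (m * n ^ 4) + 1) + 1) + 1)
          \<le> 600 * (m * n ^ 4 + 1)" .
    next
      fix s' assume "\<exists>S. round_inv m {} S (s' ''ans'' 0)"
      then obtain S where S: "round_inv m {} S (s' ''ans'' 0)" by blast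
      show "s' ''ans'' 0 = (if has_clique_matching E k then 1 else 0)"
      proof (cases "has_clique_matching E k")
        case True
        \<comment> \<open>After \<open>m\<close> rounds every level below \<open>m\<close> has been
          tested, so this witness has set \<open>ans\<close> to \<open>1\<close>.\<close>
        then obtain r x y where "r < m" "(x, y) \<in> level {0..<n} E k r" "k \<le> card (cl x y)"
          using has_clique_matching_level[OF G True k] unfolding m_def by blast
        then show ?thesis using S True unfolding round_inv_def by auto
      next
        case False
        \<comment> \<open>The invariant lets \<open>ans\<close> be \<open>1\<close> only if some
          pair of some level passes the test, and \<open>level_sound\<close> would turn that pair
          into a clique-matching.\<close>
        have "s' ''ans'' 0 \<noteq> 1"
        proof
          assume "s' ''ans'' 0 = 1"
          then obtain r x y where "(x, y) \<in> level {0..<n} E k r" "k \<le> card (cl x y)"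
            using S unfolding round_inv_def by auto
          then show False using level_sound[OF g bip k] False by blast
        qed
        then show ?thesis using S False unfolding round_inv_def by auto
      qed
    qed
  qed
  then show ?thesis
    unfolding decides_within_def runs_def s_def m_def by blast
qed

theorem theorem2:
  "\<exists>(p :: com) (C :: nat).
     \<forall>(n :: nat) (E :: nat set set) (es :: (nat \<times> nat) list) (k :: nat).
       bipartite_permutation_graph {0..<n} E \<longrightarrow> edge_listing E es \<longrightarrow> k \<ge> 1 \<longrightarrow>
         decides_within p (input_state n es k) (has_clique_matching E k)
           (C * (card E * n ^ 4 + 1))"
  using clique_matching_program_decides by blast

end
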